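(* For any DG-category $\mathbf A$ with shifts and cones, there is a fully faithful DG-functor $\natural\natural\colon\mathbf A\to\mathbf A^{\natural\natural}=(\mathbf A^\natural)^\natural$ given on objects by the rule $A\mapsto\operatorname{cone}(\mathrm{id}_A[-1])$ (with the natural structure endomorphisms of degrees $-1$ and $1$ described in the context). The DG-functor $\natural\natural\colon\mathbf A\to\mathbf A^{\natural\natural}$ is an equivalence of DG-categories whenever $\mathbf A$ is an idempotent-complete additive DG-category with twists.
   Context: Gradings: fix an abelian group $\Gamma$, a symmetric bilinear form $\sigma\colon\Gamma\times\Gamma\to\mathbb Z/2$ and an element $\mathbf 1\in\Gamma$ with $\sigma(\mathbf 1,\mathbf 1)=1$; complexes are $\Gamma$-graded with differentials of degree $\mathbf 1$ (an integer $n$ denotes $n\cdot\mathbf 1$; $(-1)^i$ means $(-1)^{\sigma(\mathbf 1,i)}$), and signs follow the Koszul rule with $(-1)^{\sigma(a,b)}$ (standard case: $\Gamma=\mathbb Z$, $\sigma(a,b)=ab\bmod 2$). A DG-category $\mathbf A$ is a category enriched in complexes of abelian groups. $\mathsf Z^0(\mathbf A)$ is the preadditive category with the same objects and the degree-$0$ cocycles (closed morphisms of degree $0$) as morphisms. $\mathbf A$ is called additive, resp. idempotent-complete, if $\mathsf Z^0(\mathbf A)$ is additive, resp. additive with all idempotent endomorphisms splitting. Shift $X[i]$: an object with mutually inverse closed morphisms in $\operatorname{Hom}^{-i}_{\mathbf A}(X,X[i])$ and $\operatorname{Hom}^{i}_{\mathbf A}(X[i],X)$. The cone of a closed degree-$0$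 morphism $f\colon X\to Y$ is an object $C$ with isomorphisms, functorial in $Z\in\mathbf A$, between $\operatorname{Hom}^\bullet_{\mathbf A}(Z,C)$ and the cone of $\operatorname{Hom}^\bullet_{\mathbf A}(Z,X)\to\operatorname{Hom}^\bullet_{\mathbf A}(Z,Y)$. A Maurer–Cartan cochain is $a\in\operatorname{Hom}^1_{\mathbf A}(X,X)$ with $d(a)+a^2=0$; the twist $X(a)$ is an object $Y$ with mutually inverse $f\in\operatorname{Hom}^0(X,Y)$, $g\in\operatorname{Hom}^0(Y,X)$ such that $d(f)=fa$. "With shifts/cones/twists" means all of them exist. A DG-functor is fully faithful if it induces termwise isomorphisms of the complexes of morphisms (not merely quasi-isomorphisms); it is an equivalence if, in addition, every object of the target is isomorphic, by a closed isomorphism of degree $0$, to an object in the image. The DG-category $\mathbf A^\natural$: objects are pairs $(X,\sigma_X)$ with $X\in\mathbf A$, $\sigma_X\in\operatorname{Hom}^{-1}_{\mathbf A}(X,X)$, $d(\sigma_X)=\mathrm{id}_X$, $\sigma_X^2=0$; $\operatorname{Hom}^i_{\mathbf A^\natural}((X,\sigma_X),(Y,\sigma_Y))$ is the group of closed morphisms $X\to Y$ of degree $-i$ in $\mathbf A$, with differential $d^\natural(f)=\sigma_Yf-(-1)^if\sigma_X$, and composition as in $\mathbf A$. Thus objects of $\mathbf A^{\natural\natural}$ are triples $(W,\sigma,\tau)$ with $\sigma\in\operatorname{Hom}^{-1}_{\mathbf A}(W,W)$, $\tau\in\operatorname{Hom}^{1}_{\mathbf A}(W,W)$, $\sigma^2=0=\tau^2$,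 $\sigma\tau+\tau\sigma=\mathrm{id}_W$, $d(\sigma)=\mathrm{id}_W$, $d(\tau)=0$. The object $E=\operatorname{cone}(\mathrm{id}_A[-1])$ comes with closed morphisms $\iota_A\in\operatorname{Hom}^1(A,E)$, $\pi_A\in\operatorname{Hom}^0(E,A)$ and morphisms $\pi'_A\in\operatorname{Hom}^{-1}(E,A)$, $\iota'_A\in\operatorname{Hom}^0(A,E)$ such that $\pi'_A\iota'_A=0=\pi_A\iota_A$, $\pi'_A\iota_A=\mathrm{id}_A=\pi_A\iota'_A$, $\iota_A\pi'_A+\iota'_A\pi_A=\mathrm{id}_E$, $d(\pi'_A)=\pi_A$, $d(\iota'_A)=\iota_A$. The functor $\natural\natural$ takes $A$ to $(E,\ \sigma_E=\iota'_A\pi'_A,\ \tau_E=\iota_A\pi_A)$ and $f\in\operatorname{Hom}^i_{\mathbf A}(A,B)$ to $(-1)^i\iota'_Bf\pi_A+\iota_Bf\pi'_A+\iota'_Bd(f)\pi'_A$. *)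

theory Defs
  imports "HOL-Algebra.Chinese_Remainder" "HOL-Library.Z2"
begin

section \<open>Gradings and complexes of abelian groups\<close>

text \<open>
  The grading group is a type of class \<^class>\<open>ab_group_add\<close>; \<open>parity\<close> is the bilinear form with
  values in Z/2 (the type \<^typ>\<open>bit\<close>) and \<open>deg1\<close> is the distinguished element, the degree of
  differentials.
\<close>

record 'g grading =
  parity :: "'g \<Rightarrow> 'g \<Rightarrow> bit"
  deg1 :: 'g

locale grading =
  fixes \<Gamma> :: "('g::ab_group_add) grading"
  assumes parity_add_left: "parity \<Gamma> (i + j) k = parity \<Gamma> i k + parity \<Gamma> j k"
    and parity_sym: "parity \<Gamma> i j = parity \<Gamma> j i"
    and parity_deg1: "parity \<Gamma> (deg1 \<Gamma>) (deg1 \<Gamma>) = 1"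

text \<open>
  Abelian groups are rendered, as for modules in HOL-Algebra, by \<^locale>\<open>abelian_group\<close> on ring
  records: only carrier, zero and addition are used, the multiplicative fields are meaningless.
  \<open>koszul \<Gamma> G i x\<close> is \<open>(-1)^i x\<close>, i.e. \<open>x\<close> multiplied by \<open>-1\<close> to the power \<open>parity deg1 i\<close>.
\<close>

definition koszul :: "('g::ab_group_add) grading \<Rightarrow> 'm ring \<Rightarrow> 'g \<Rightarrow> 'm \<Rightarrow> 'm" where
  "koszul \<Gamma> G i x = (if parity \<Gamma> (deg1 \<Gamma>) i = 0 then x else \<ominus>\<^bsub>G\<^esub> x)"

record ('g, 'm) cpx =
  grp :: "'g \<Rightarrow> 'm ring"
  dif :: "'g \<Rightarrow> 'm \<Rightarrow> 'm"

definition cochain_complex :: "('g::ab_group_add) grading \<Rightarrow> ('g, 'm) cpx \<Rightarrow> bool" where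
  "cochain_complex \<Gamma> K \<longleftrightarrow>
     (\<forall>n. abelian_group (grp K n)) \<and>
     (\<forall>n. dif K n \<in> hom (add_monoid (grp K n)) (add_monoid (grp K (n + deg1 \<Gamma>)))) \<and>
     (\<forall>n. \<forall>x \<in> carrier (grp K n).
        dif K (n + deg1 \<Gamma>) (dif K n x) = \<zero>\<^bsub>grp K (n + deg1 \<Gamma> + deg1 \<Gamma>)\<^esub>)"

definition chain_map ::
  "('g::ab_group_add) grading \<Rightarrow> ('g, 'a) cpx \<Rightarrow> ('g, 'b) cpx \<Rightarrow> ('g \<Rightarrow> 'a \<Rightarrow> 'b) \<Rightarrow> bool" where
  "chain_map \<Gamma> K L \<phi> \<longleftrightarrow>
     (\<forall>n. \<phi> n \<in> hom (add_monoid (grp K n)) (add_monoid (grp L n))) \<and>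
     (\<forall>n. \<forall>x \<in> carrier (grp K n). dif L n (\<phi> n x) = \<phi> (n + deg1 \<Gamma>) (dif K n x))"

definition complex_iso ::
  "('g::ab_group_add) grading \<Rightarrow> ('g, 'a) cpx \<Rightarrow> ('g, 'b) cpx \<Rightarrow> ('g \<Rightarrow> 'a \<Rightarrow> 'b) \<Rightarrow> bool" where
  "complex_iso \<Gamma> K L \<phi> \<longleftrightarrow>
     chain_map \<Gamma> K L \<phi> \<and> (\<forall>n. bij_betw (\<phi> n) (carrier (grp K n)) (carrier (grp L n)))"

text \<open>
  The cone of \<open>\<phi> : K \<rightarrow> L\<close> has \<open>L^n \<oplus> K^(n+1)\<close> in degree \<open>n\<close>, with
  \<open>d (y, x) = (d y + \<phi> x, - d x)\<close>.
\<close>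

definition cone_cpx ::
  "('g::ab_group_add) grading \<Rightarrow> ('g, 'a) cpx \<Rightarrow> ('g, 'b) cpx \<Rightarrow> ('g \<Rightarrow> 'a \<Rightarrow> 'b) \<Rightarrow> ('g, 'b \<times> 'a) cpx"
  where
  "cone_cpx \<Gamma> K L \<phi> =
     \<lparr> grp = (\<lambda>n. RDirProd (grp L n) (grp K (n + deg1 \<Gamma>))),
       dif = (\<lambda>n (y, x).
         (dif L n y \<oplus>\<^bsub>grp L (n + deg1 \<Gamma>)\<^esub> \<phi> (n + deg1 \<Gamma>) x,
          \<ominus>\<^bsub>grp K (n + deg1 \<Gamma> + deg1 \<Gamma>)\<^esub> dif K (n + deg1 \<Gamma>) x)) \<rparr>"


section \<open>DG-categories\<close>

text \<open>
  \<open>Cmp A g f\<close> is the composite \<open>g \<circ> f\<close>. The sets of morphisms for different source, target and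
  degree need not be disjoint; when they are (tag morphisms by these data), a single operation
  on the type of morphisms encodes an arbitrary family of composition maps.
\<close>

record ('g, 'o, 'm) dgcat =
  Obj :: "'o set"
  Hom :: "'o \<Rightarrow> 'o \<Rightarrow> ('g, 'm) cpx"
  Idm :: "'o \<Rightarrow> 'm"
  Cmp :: "'m \<Rightarrow> 'm \<Rightarrow> 'm"

abbreviation HomG :: "('g, 'o, 'm) dgcat \<Rightarrow> 'o \<Rightarrow> 'o \<Rightarrow> 'g \<Rightarrow> 'm ring" where
  "HomG A X Y n \<equiv> grp (Hom A X Y) n"

abbreviation mor :: "('g, 'o, 'm) dgcat \<Rightarrow> 'o \<Rightarrow> 'o \<Rightarrow> 'g \<Rightarrow> 'm set" where
  "mor A X Y n \<equiv> carrier (HomG A X Y n)"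

abbreviation Dif :: "('g, 'o, 'm) dgcat \<Rightarrow> 'o \<Rightarrow> 'o \<Rightarrow> 'g \<Rightarrow> 'm \<Rightarrow> 'm" where
  "Dif A X Y n \<equiv> dif (Hom A X Y) n"

locale dg_category = grading \<Gamma> for \<Gamma> :: "('g::ab_group_add) grading" +
  fixes A :: "('g, 'o, 'm) dgcat"
  assumes Hom_complex:
      "\<lbrakk>X \<in> Obj A; Y \<in> Obj A\<rbrakk> \<Longrightarrow> cochain_complex \<Gamma> (Hom A X Y)"
    and Idm_mor: "X \<in> Obj A \<Longrightarrow> Idm A X \<in> mor A X X 0"
    and Idm_closed: "X \<in> Obj A \<Longrightarrow> Dif A X X 0 (Idm A X) = \<zero>\<^bsub>HomG A X X (0 + deg1 \<Gamma>)\<^esub>"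
    and Cmp_mor:
      "\<lbrakk>X \<in> Obj A; Y \<in> Obj A; Z \<in> Obj A; f \<in> mor A X Y i; g \<in> mor A Y Z j\<rbrakk>
       \<Longrightarrow> Cmp A g f \<in> mor A X Z (j + i)"
    and Cmp_add_left:
      "\<lbrakk>X \<in> Obj A; Y \<in> Obj A; Z \<in> Obj A; f \<in> mor A X Y i; g \<in> mor A Y Z j; g' \<in> mor A Y Z j\<rbrakk>
       \<Longrightarrow> Cmp A (g \<oplus>\<^bsub>HomG A Y Z j\<^esub> g') f = Cmp A g f \<oplus>\<^bsub>HomG A X Z (j + i)\<^esub> Cmp A g' f"
    and Cmp_add_right:
      "\<lbrakk>X \<in> Obj A; Y \<in> Obj A; Z \<in> Obj A; f \<in> mor A X Y i; f' \<in> mor A X Y i; g \<in> mor A Y Z j\<rbrakk>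
       \<Longrightarrow> Cmp A g (f \<oplus>\<^bsub>HomG A X Y i\<^esub> f') = Cmp A g f \<oplus>\<^bsub>HomG A X Z (j + i)\<^esub> Cmp A g f'"
    and Cmp_assoc:
      "\<lbrakk>W \<in> Obj A; X \<in> Obj A; Y \<in> Obj A; Z \<in> Obj A;
        f \<in> mor A W X i; g \<in> mor A X Y j; h \<in> mor A Y Z k\<rbrakk>
       \<Longrightarrow> Cmp A (Cmp A h g) f = Cmp A h (Cmp A g f)"
    and Cmp_Idm_left:
      "\<lbrakk>X \<in> Obj A; Y \<in> Obj A; f \<in> mor A X Y i\<rbrakk> \<Longrightarrow> Cmp A (Idm A Y) f = f"
    and Cmp_Idm_right:
      "\<lbrakk>X \<in> Obj A; Y \<in> Obj A; f \<in> mor A X Y i\<rbrakk> \<Longrightarrow> Cmp A f (Idm A X) = f"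
    and Leibniz:
      "\<lbrakk>X \<in> Obj A; Y \<in> Obj A; Z \<in> Obj A; f \<in> mor A X Y i; g \<in> mor A Y Z j\<rbrakk>
       \<Longrightarrow> Dif A X Z (j + i) (Cmp A g f) =
             Cmp A (Dif A Y Z j g) f
             \<oplus>\<^bsub>HomG A X Z (j + i + deg1 \<Gamma>)\<^esub>
             koszul \<Gamma> (HomG A X Z (j + i + deg1 \<Gamma>)) j (Cmp A g (Dif A X Y i f))"

definition closed_mor ::
  "('g::ab_group_add) grading \<Rightarrow> ('g, 'o, 'm) dgcat \<Rightarrow> 'o \<Rightarrow> 'o \<Rightarrow> 'g \<Rightarrow> 'm set" where
  "closed_mor \<Gamma> A X Y n = {f \<in> mor A X Y n. Dif A X Y n f = \<zero>\<^bsub>HomG A X Y (n + deg1 \<Gamma>)\<^esub>}"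


section \<open>The preadditive category of closed morphisms of degree 0\<close>

record ('o, 'm) precat =
  pObj :: "'o set"
  pHom :: "'o \<Rightarrow> 'o \<Rightarrow> 'm ring"
  pIdm :: "'o \<Rightarrow> 'm"
  pCmp :: "'m \<Rightarrow> 'm \<Rightarrow> 'm"

locale preadditive_category =
  fixes C :: "('o, 'm) precat"
  assumes pHom_group: "\<lbrakk>X \<in> pObj C; Y \<in> pObj C\<rbrakk> \<Longrightarrow> abelian_group (pHom C X Y)"
    and pIdm_mor: "X \<in> pObj C \<Longrightarrow> pIdm C X \<in> carrier (pHom C X X)"
    and pCmp_mor:
      "\<lbrakk>X \<in> pObj C; Y \<in> pObj C; Z \<in> pObj C; f \<in> carrier (pHom C X Y); g \<in> carrier (pHom C Y Z)\<rbrakk>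
       \<Longrightarrow> pCmp C g f \<in> carrier (pHom C X Z)"
    and pCmp_add_left:
      "\<lbrakk>X \<in> pObj C; Y \<in> pObj C; Z \<in> pObj C; f \<in> carrier (pHom C X Y);
        g \<in> carrier (pHom C Y Z); g' \<in> carrier (pHom C Y Z)\<rbrakk>
       \<Longrightarrow> pCmp C (g \<oplus>\<^bsub>pHom C Y Z\<^esub> g') f = pCmp C g f \<oplus>\<^bsub>pHom C X Z\<^esub> pCmp C g' f"
    and pCmp_add_right:
      "\<lbrakk>X \<in> pObj C; Y \<in> pObj C; Z \<in> pObj C; f \<in> carrier (pHom C X Y);
        f' \<in> carrier (pHom C X Y); g \<in> carrier (pHom C Y Z)\<rbrakk>
       \<Longrightarrow> pCmp C g (f \<oplus>\<^bsub>pHom C X Y\<^esub> f') = pCmp C g f \<oplus>\<^bsub>pHom C X Z\<^esub> pCmp C g f'"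
    and pCmp_assoc:
      "\<lbrakk>W \<in> pObj C; X \<in> pObj C; Y \<in> pObj C; Z \<in> pObj C;
        f \<in> carrier (pHom C W X); g \<in> carrier (pHom C X Y); h \<in> carrier (pHom C Y Z)\<rbrakk>
       \<Longrightarrow> pCmp C (pCmp C h g) f = pCmp C h (pCmp C g f)"
    and pCmp_Idm_left:
      "\<lbrakk>X \<in> pObj C; Y \<in> pObj C; f \<in> carrier (pHom C X Y)\<rbrakk> \<Longrightarrow> pCmp C (pIdm C Y) f = f"
    and pCmp_Idm_right:
      "\<lbrakk>X \<in> pObj C; Y \<in> pObj C; f \<in> carrier (pHom C X Y)\<rbrakk> \<Longrightarrow> pCmp C f (pIdm C X) = f"

definition zero_object :: "('o, 'm) precat \<Rightarrow> 'o \<Rightarrow> bool" where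
  "zero_object C N \<longleftrightarrow> N \<in> pObj C \<and>
     (\<forall>X \<in> pObj C. (\<exists>!f. f \<in> carrier (pHom C X N)) \<and> (\<exists>!f. f \<in> carrier (pHom C N X)))"

definition biproduct :: "('o, 'm) precat \<Rightarrow> 'o \<Rightarrow> 'o \<Rightarrow> 'o \<Rightarrow> bool" where
  "biproduct C X Y P \<longleftrightarrow> P \<in> pObj C \<and>
     (\<exists>i \<in> carrier (pHom C X P). \<exists>j \<in> carrier (pHom C Y P).
      \<exists>p \<in> carrier (pHom C P X). \<exists>q \<in> carrier (pHom C P Y).
        pCmp C p i = pIdm C X \<and> pCmp C q j = pIdm C Y \<and>
        pCmp C p j = \<zero>\<^bsub>pHom C Y X\<^esub> \<and> pCmp C q i = \<zero>\<^bsub>pHom C X Y\<^esub> \<and>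
        pCmp C i p \<oplus>\<^bsub>pHom C P P\<^esub> pCmp C j q = pIdm C P)"

definition additive_category :: "('o, 'm) precat \<Rightarrow> bool" where
  "additive_category C \<longleftrightarrow> preadditive_category C \<and> (\<exists>N. zero_object C N) \<and>
     (\<forall>X \<in> pObj C. \<forall>Y \<in> pObj C. \<exists>P. biproduct C X Y P)"

definition idempotents_split :: "('o, 'm) precat \<Rightarrow> bool" where
  "idempotents_split C \<longleftrightarrow>
     (\<forall>X \<in> pObj C. \<forall>e \<in> carrier (pHom C X X). pCmp C e e = e \<longrightarrow>
        (\<exists>Y \<in> pObj C. \<exists>r \<in> carrier (pHom C X Y). \<exists>s \<in> carrier (pHom C Y X).
           pCmp C s r = e \<and> pCmp C r s = pIdm C Y))"

definition Z0 :: "('g::ab_group_add) grading \<Rightarrow> ('g, 'o, 'm) dgcat \<Rightarrow> ('o, 'm) precat" where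
  "Z0 \<Gamma> A =
     \<lparr> pObj = Obj A,
       pHom = (\<lambda>X Y. (HomG A X Y 0)\<lparr>carrier := closed_mor \<Gamma> A X Y 0\<rparr>),
       pIdm = Idm A,
       pCmp = Cmp A \<rparr>"

definition idempotent_complete_additive_dg ::
  "('g::ab_group_add) grading \<Rightarrow> ('g, 'o, 'm) dgcat \<Rightarrow> bool" where
  "idempotent_complete_additive_dg \<Gamma> A \<longleftrightarrow>
     additive_category (Z0 \<Gamma> A) \<and> idempotents_split (Z0 \<Gamma> A)"


section \<open>Shifts, cones and twists\<close>

definition is_shift ::
  "('g::ab_group_add) grading \<Rightarrow> ('g, 'o, 'm) dgcat \<Rightarrow> 'o \<Rightarrow> 'g \<Rightarrow> 'o \<Rightarrow> bool" where
  "is_shift \<Gamma> A X i S \<longleftrightarrow> S \<in> Obj A \<and>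
     (\<exists>u \<in> closed_mor \<Gamma> A X S (- i). \<exists>v \<in> closed_mor \<Gamma> A S X i.
        Cmp A v u = Idm A X \<and> Cmp A u v = Idm A S)"

text \<open>
  \<open>C\<close> represents the cone of \<open>f : X \<rightarrow> Y\<close>. The isomorphisms are DG-functorial in \<open>Z\<close>: they
  respect composition on the right with morphisms \<open>h : Z' \<rightarrow> Z\<close> of every degree; no sign occurs in
  this right action with the conventions of \<^const>\<open>cone_cpx\<close>.
\<close>

definition is_cone ::
  "('g::ab_group_add) grading \<Rightarrow> ('g, 'o, 'm) dgcat \<Rightarrow> 'o \<Rightarrow> 'o \<Rightarrow> 'm \<Rightarrow> 'o \<Rightarrow> bool" where
  "is_cone \<Gamma> A X Y f C \<longleftrightarrow> C \<in> Obj A \<and>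
     (\<exists>\<Phi> :: 'o \<Rightarrow> 'g \<Rightarrow> 'm \<Rightarrow> 'm \<times> 'm.
        (\<forall>Z \<in> Obj A.
           complex_iso \<Gamma> (Hom A Z C)
             (cone_cpx \<Gamma> (Hom A Z X) (Hom A Z Y) (\<lambda>n. Cmp A f)) (\<Phi> Z)) \<and>
        (\<forall>Z \<in> Obj A. \<forall>Z' \<in> Obj A. \<forall>n j. \<forall>g \<in> mor A Z C n. \<forall>h \<in> mor A Z' Z j.
           \<Phi> Z' (n + j) (Cmp A g h) = (Cmp A (fst (\<Phi> Z n g)) h, Cmp A (snd (\<Phi> Z n g)) h)))"

definition maurer_cartan ::
  "('g::ab_group_add) grading \<Rightarrow> ('g, 'o, 'm) dgcat \<Rightarrow> 'o \<Rightarrow> 'm \<Rightarrow> bool" where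
  "maurer_cartan \<Gamma> A X a \<longleftrightarrow> a \<in> mor A X X (deg1 \<Gamma>) \<and>
     Dif A X X (deg1 \<Gamma>) a \<oplus>\<^bsub>HomG A X X (deg1 \<Gamma> + deg1 \<Gamma>)\<^esub> Cmp A a a
       = \<zero>\<^bsub>HomG A X X (deg1 \<Gamma> + deg1 \<Gamma>)\<^esub>"

definition is_twist :: "('g::ab_group_add, 'o, 'm) dgcat \<Rightarrow> 'o \<Rightarrow> 'm \<Rightarrow> 'o \<Rightarrow> bool" where
  "is_twist A X a Y \<longleftrightarrow> Y \<in> Obj A \<and>
     (\<exists>f \<in> mor A X Y 0. \<exists>g \<in> mor A Y X 0.
        Cmp A g f = Idm A X \<and> Cmp A f g = Idm A Y \<and> Dif A X Y 0 f = Cmp A f a)"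

definition has_shifts :: "('g::ab_group_add) grading \<Rightarrow> ('g, 'o, 'm) dgcat \<Rightarrow> bool" where
  "has_shifts \<Gamma> A \<longleftrightarrow> (\<forall>X \<in> Obj A. \<forall>i. \<exists>S. is_shift \<Gamma> A X i S)"

definition has_cones :: "('g::ab_group_add) grading \<Rightarrow> ('g, 'o, 'm) dgcat \<Rightarrow> bool" where
  "has_cones \<Gamma> A \<longleftrightarrow>
     (\<forall>X \<in> Obj A. \<forall>Y \<in> Obj A. \<forall>f \<in> closed_mor \<Gamma> A X Y 0. \<exists>C. is_cone \<Gamma> A X Y f C)"

definition has_twists :: "('g::ab_group_add) grading \<Rightarrow> ('g, 'o, 'm) dgcat \<Rightarrow> bool" where
  "has_twists \<Gamma> A \<longleftrightarrow>
     (\<forall>X \<in> Obj A. \<forall>a. maurer_cartan \<Gamma> A X a \<longrightarrow> (\<exists>Y. is_twist A X a Y))"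


section \<open>DG-functors\<close>

locale dg_functor =
  A: dg_category \<Gamma> A + B: dg_category \<Gamma> B
  for \<Gamma> :: "('g::ab_group_add) grading"
    and A :: "('g, 'o, 'm) dgcat" and B :: "('g, 'p, 'n) dgcat" +
  fixes Fo :: "'o \<Rightarrow> 'p" and Fm :: "'o \<Rightarrow> 'o \<Rightarrow> 'g \<Rightarrow> 'm \<Rightarrow> 'n"
  assumes Fo_Obj: "X \<in> Obj A \<Longrightarrow> Fo X \<in> Obj B"
    and Fm_chain_map:
      "\<lbrakk>X \<in> Obj A; Y \<in> Obj A\<rbrakk> \<Longrightarrow> chain_map \<Gamma> (Hom A X Y) (Hom B (Fo X) (Fo Y)) (Fm X Y)"
    and Fm_Idm: "X \<in> Obj A \<Longrightarrow> Fm X X 0 (Idm A X) = Idm B (Fo X)"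
    and Fm_Cmp:
      "\<lbrakk>X \<in> Obj A; Y \<in> Obj A; Z \<in> Obj A; f \<in> mor A X Y i; g \<in> mor A Y Z j\<rbrakk>
       \<Longrightarrow> Fm X Z (j + i) (Cmp A g f) = Cmp B (Fm Y Z j g) (Fm X Y i f)"

definition fully_faithful ::
  "('g::ab_group_add) grading \<Rightarrow> ('g, 'o, 'm) dgcat \<Rightarrow> ('g, 'p, 'n) dgcat
   \<Rightarrow> ('o \<Rightarrow> 'p) \<Rightarrow> ('o \<Rightarrow> 'o \<Rightarrow> 'g \<Rightarrow> 'm \<Rightarrow> 'n) \<Rightarrow> bool" where
  "fully_faithful \<Gamma> A B Fo Fm \<longleftrightarrow>
     (\<forall>X \<in> Obj A. \<forall>Y \<in> Obj A. complex_iso \<Gamma> (Hom A X Y) (Hom B (Fo X) (Fo Y)) (Fm X Y))"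

definition closed_isomorphic ::
  "('g::ab_group_add) grading \<Rightarrow> ('g, 'o, 'm) dgcat \<Rightarrow> 'o \<Rightarrow> 'o \<Rightarrow> bool" where
  "closed_isomorphic \<Gamma> A X Y \<longleftrightarrow>
     (\<exists>f \<in> closed_mor \<Gamma> A X Y 0. \<exists>g \<in> closed_mor \<Gamma> A Y X 0.
        Cmp A g f = Idm A X \<and> Cmp A f g = Idm A Y)"

definition dg_equivalence ::
  "('g::ab_group_add) grading \<Rightarrow> ('g, 'o, 'm) dgcat \<Rightarrow> ('g, 'p, 'n) dgcat
   \<Rightarrow> ('o \<Rightarrow> 'p) \<Rightarrow> ('o \<Rightarrow> 'o \<Rightarrow> 'g \<Rightarrow> 'm \<Rightarrow> 'n) \<Rightarrow> bool" where
  "dg_equivalence \<Gamma> A B Fo Fm \<longleftrightarrow>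
     dg_functor \<Gamma> A B Fo Fm \<and> fully_faithful \<Gamma> A B Fo Fm \<and>
     (\<forall>Y \<in> Obj B. \<exists>X \<in> Obj A. closed_isomorphic \<Gamma> B (Fo X) Y)"


section \<open>The DG-category \<open>A\<^sup>\<natural>\<close> and the functor \<open>\<natural>\<natural>\<close>\<close>

definition nat_dg :: "('g::ab_group_add) grading \<Rightarrow> ('g, 'o, 'm) dgcat \<Rightarrow> ('g, 'o \<times> 'm, 'm) dgcat" where
  "nat_dg \<Gamma> A =
     \<lparr> Obj = {(X, s). X \<in> Obj A \<and> s \<in> mor A X X (- deg1 \<Gamma>) \<and>
                Dif A X X (- deg1 \<Gamma>) s = Idm A X \<and>
                Cmp A s s = \<zero>\<^bsub>HomG A X X (- deg1 \<Gamma> + - deg1 \<Gamma>)\<^esub>},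
       Hom = (\<lambda>(X, s) (Y, t).
         \<lparr> grp = (\<lambda>i. (HomG A X Y (- i))\<lparr>carrier := closed_mor \<Gamma> A X Y (- i)\<rparr>),
           dif = (\<lambda>i f. Cmp A t f \<ominus>\<^bsub>HomG A X Y (- (i + deg1 \<Gamma>))\<^esub>
                          koszul \<Gamma> (HomG A X Y (- (i + deg1 \<Gamma>))) i (Cmp A f s)) \<rparr>),
       Idm = (\<lambda>(X, s). Idm A X),
       Cmp = Cmp A \<rparr>"

text \<open>
  For every object \<open>X\<close>: the object \<open>E = cone(id_X[-1])\<close> with the morphisms \<open>\<iota>\<close>, \<open>\<pi>\<close>, \<open>\<iota>'\<close>, \<open>\<pi>'\<close>
  that it comes with. Since shifts and cones are determined only up to isomorphism, this is a
  choice, and the functor is defined for each choice.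
\<close>

record ('o, 'm) cone_choice =
  cE :: "'o \<Rightarrow> 'o"
  c\<iota> :: "'o \<Rightarrow> 'm"
  c\<pi> :: "'o \<Rightarrow> 'm"
  c\<iota>' :: "'o \<Rightarrow> 'm"
  c\<pi>' :: "'o \<Rightarrow> 'm"

definition cone_choice_ok ::
  "('g::ab_group_add) grading \<Rightarrow> ('g, 'o, 'm) dgcat \<Rightarrow> ('o, 'm) cone_choice \<Rightarrow> bool" where
  "cone_choice_ok \<Gamma> A c \<longleftrightarrow>
     (\<forall>X \<in> Obj A. let E = cE c X; \<iota> = c\<iota> c X; \<pi> = c\<pi> c X; \<iota>' = c\<iota>' c X; \<pi>' = c\<pi>' c X in
        (\<exists>S. is_shift \<Gamma> A X (- deg1 \<Gamma>) S \<and> is_cone \<Gamma> A S S (Idm A S) E) \<and>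
        \<iota> \<in> closed_mor \<Gamma> A X E (deg1 \<Gamma>) \<and> \<pi> \<in> closed_mor \<Gamma> A E X 0 \<and>
        \<pi>' \<in> mor A E X (- deg1 \<Gamma>) \<and> \<iota>' \<in> mor A X E 0 \<and>
        Cmp A \<pi>' \<iota>' = \<zero>\<^bsub>HomG A X X (- deg1 \<Gamma>)\<^esub> \<and> Cmp A \<pi> \<iota> = \<zero>\<^bsub>HomG A X X (deg1 \<Gamma>)\<^esub> \<and>
        Cmp A \<pi>' \<iota> = Idm A X \<and> Cmp A \<pi> \<iota>' = Idm A X \<and>
        Cmp A \<iota> \<pi>' \<oplus>\<^bsub>HomG A E E 0\<^esub> Cmp A \<iota>' \<pi> = Idm A E \<and>
        Dif A E X (- deg1 \<Gamma>) \<pi>' = \<pi> \<and> Dif A X E 0 \<iota>' = \<iota>)"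

definition natnat_obj :: "('g, 'o, 'm) dgcat \<Rightarrow> ('o, 'm) cone_choice \<Rightarrow> 'o \<Rightarrow> ('o \<times> 'm) \<times> 'm" where
  "natnat_obj A c X =
     ((cE c X, Cmp A (c\<iota>' c X) (c\<pi>' c X)), Cmp A (c\<iota> c X) (c\<pi> c X))"

definition natnat_mor ::
  "('g::ab_group_add) grading \<Rightarrow> ('g, 'o, 'm) dgcat \<Rightarrow> ('o, 'm) cone_choice
   \<Rightarrow> 'o \<Rightarrow> 'o \<Rightarrow> 'g \<Rightarrow> 'm \<Rightarrow> 'm" where
  "natnat_mor \<Gamma> A c X Y i f =
     koszul \<Gamma> (HomG A (cE c X) (cE c Y) i) i (Cmp A (c\<iota>' c Y) (Cmp A f (c\<pi> c X)))
     \<oplus>\<^bsub>HomG A (cE c X) (cE c Y) i\<^esub> Cmp A (c\<iota> c Y) (Cmp A f (c\<pi>' c X))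
     \<oplus>\<^bsub>HomG A (cE c X) (cE c Y) i\<^esub> Cmp A (c\<iota>' c Y) (Cmp A (Dif A X Y i f) (c\<pi>' c X))"

end

theory Submission
  imports Defs
begin

text \<open>
  An object of \<open>A\<^sup>\<natural>\<^sup>\<natural>\<close> is an object \<open>W\<close> of \<open>A\<close> with \<open>\<sigma>\<close> of degree \<open>-1\<close> and a closed \<open>\<tau>\<close> of degree \<open>1\<close> such that
  \<open>d \<sigma> = id\<close>, \<open>\<sigma>\<sigma> = 0 = \<tau>\<tau>\<close> and \<open>\<sigma>\<tau> + \<tau>\<sigma> = id\<close>. Hence \<open>\<sigma>\<tau>\<close> and \<open>\<tau>\<sigma>\<close> are complementary idempotents, and
  \<open>\<sigma>\<close>, \<open>\<tau>\<close> identify their images up to a shift: where these images exist, \<open>W\<close> without its differential is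
  the sum of one object and a shift of it. The cone \<open>E\<close> of \<open>id_X[-1]\<close> with \<open>\<sigma> = \<iota>'\<pi>'\<close>, \<open>\<tau> = \<iota>\<pi>\<close> has this shape.

  The functor is fully faithful. A morphism \<open>h : E_X \<rightarrow> E_Y\<close> of \<open>A\<^sup>\<natural>\<^sup>\<natural>\<close> is a closed morphism of \<open>A\<close> that
  commutes with \<open>\<sigma>\<close> in the graded sense. Put \<open>f = \<pi>' h \<iota>\<close>. Commutation with \<open>\<iota>'\<pi>'\<close> forces
  \<open>h \<iota>' = \<plusminus> \<iota>' f\<close>; applying \<open>d\<close>, closedness of \<open>h\<close> and \<open>d \<iota>' = \<iota>\<close> then give \<open>h \<iota>\<close> in terms of \<open>f\<close> and \<open>d f\<close>.
  Since \<open>\<iota>\<pi>' + \<iota>'\<pi> = id\<close>, these two composites determine \<open>h\<close>, and \<open>h\<close> is the value of the functor at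
  \<open>f\<close> (lemma \<open>cone_map_full\<close>). The failure of \<open>h\<close> to commute with \<open>\<tau>\<close> is its differential in \<open>A\<^sup>\<natural>\<^sup>\<natural>\<close>, and it
  is the value of the functor at \<open>d f\<close> (lemma \<open>cone_map_tau\<close>).

  The functor is essentially surjective when twists exist and idempotents split. Given \<open>(W, \<sigma>, \<tau>)\<close>,
  the idempotent \<open>\<sigma>\<tau>\<close> has degree \<open>0\<close>, but \<open>d (\<sigma>\<tau>) = \<tau>\<close>. Now \<open>-\<tau>\<close> is a Maurer-Cartan cochain, and in the
  twist \<open>W(-\<tau>)\<close> the differential of an endomorphism \<open>h\<close> of degree \<open>0\<close> becomes \<open>d h - (\<tau>h - h\<tau>)\<close>, which
  vanishes for \<open>h = \<sigma>\<tau>\<close> because \<open>\<tau>\<sigma>\<tau> = \<tau>\<close>. Split the idempotent there, and let \<open>q : B \<rightarrow> W\<close> and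
  \<open>p : W \<rightarrow> B\<close> be the resulting maps, so that \<open>p q = id\<close>, \<open>q p = \<sigma>\<tau>\<close>, \<open>d q = \<tau> q\<close> and \<open>d p = - p \<tau> = 0\<close>.
  Then \<open>\<iota> = \<tau>q\<close>, \<open>\<pi> = p\<close>, \<open>\<iota>' = q\<close>, \<open>\<pi>' = p\<sigma>\<close> make \<open>W\<close> a cone of \<open>id_B[-1]\<close> whose structure endomorphisms
  are \<open>\<sigma>\<close> and \<open>\<tau>\<close> (lemma \<open>natnat_object_is_cone\<close>), and any two cones of \<open>id_B[-1]\<close> give
  isomorphic objects of \<open>A\<^sup>\<natural>\<^sup>\<natural>\<close> (lemma \<open>natnat_obj_isomorphic\<close>).
\<close>

section \<open>Morphisms that carry their source, target and degree\<close>

text \<open>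
  In a DG-category the sum, the zero and the differential of a morphism depend on its source, target
  and degree, which cannot be recovered from the morphism. Bundling these data with it makes the laws
  of a DG-category equations between total operations on one type, whose side conditions can be
  decided by computing sources, targets and degrees. All identities between morphisms below, signs
  included, are verified by rewriting with these laws.
\<close>

datatype ('g, 'o, 'm) arrow = Arrow (src: 'o) (tgt: 'o) (deg: 'g) (val: 'm)

context grading
begin

lemma parity_add_right: "parity \<Gamma> k (i + j) = parity \<Gamma> k i + parity \<Gamma> k j"
  by (metis parity_add_left parity_sym)

lemma parity_zero_right [simp]: "parity \<Gamma> k 0 = 0"
  using parity_add_right[of k 0 0] by simp

lemma parity_minus_right [simp]: "parity \<Gamma> k (- i) = parity \<Gamma> k i"
  using parity_add_right[of k i "- i"] by (cases "parity \<Gamma> k i"; cases "parity \<Gamma> k (- i)") auto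

lemmas parity_simps = parity_add_right parity_deg1

end

context dg_category
begin

abbreviation \<delta> :: 'g where "\<delta> \<equiv> deg1 \<Gamma>"

definition valid :: "('g, 'o, 'm) arrow \<Rightarrow> bool" where
  "valid f \<longleftrightarrow> src f \<in> Obj A \<and> tgt f \<in> Obj A \<and> val f \<in> mor A (src f) (tgt f) (deg f)"

definition comp :: "('g, 'o, 'm) arrow \<Rightarrow> ('g, 'o, 'm) arrow \<Rightarrow> ('g, 'o, 'm) arrow" (infixr "\<bullet>" 75) where
  "g \<bullet> f = Arrow (src f) (tgt g) (deg g + deg f) (Cmp A (val g) (val f))"

definition plus (infixl "\<boxplus>" 65) where
  "f \<boxplus> g = Arrow (src f) (tgt f) (deg f) (val f \<oplus>\<^bsub>HomG A (src f) (tgt f) (deg f)\<^esub> val g)"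

definition neg ("\<boxminus> _" [80] 80) where
  "\<boxminus> f = Arrow (src f) (tgt f) (deg f) (\<ominus>\<^bsub>HomG A (src f) (tgt f) (deg f)\<^esub> val f)"

definition zero where "zero X Y n = Arrow X Y n \<zero>\<^bsub>HomG A X Y n\<^esub>"

definition ident :: "'o \<Rightarrow> ('g, 'o, 'm) arrow" where "ident X = Arrow X X 0 (Idm A X)"

definition D where
  "D f = Arrow (src f) (tgt f) (deg f + \<delta>) (Dif A (src f) (tgt f) (deg f) (val f))"

definition sign :: "'g \<Rightarrow> ('g, 'o, 'm) arrow \<Rightarrow> ('g, 'o, 'm) arrow" where
  "sign i f = (if parity \<Gamma> \<delta> i = 0 then f else \<boxminus> f)"

lemma HomG_group: "\<lbrakk>X \<in> Obj A; Y \<in> Obj A\<rbrakk> \<Longrightarrow> abelian_group (HomG A X Y n)"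
  using Hom_complex by (auto simp: cochain_complex_def)

lemma Dif_hom:
  "\<lbrakk>X \<in> Obj A; Y \<in> Obj A\<rbrakk>
    \<Longrightarrow> Dif A X Y n \<in> hom (add_monoid (HomG A X Y n)) (add_monoid (HomG A X Y (n + \<delta>)))"
  using Hom_complex by (auto simp: cochain_complex_def)

lemma arrow_proj [simp]:
  "src (g \<bullet> f) = src f" "tgt (g \<bullet> f) = tgt g" "deg (g \<bullet> f) = deg g + deg f"
  "src (f \<boxplus> g) = src f" "tgt (f \<boxplus> g) = tgt f" "deg (f \<boxplus> g) = deg f"
  "src (\<boxminus> f) = src f" "tgt (\<boxminus> f) = tgt f" "deg (\<boxminus> f) = deg f"
  "src (zero X Y n) = X" "tgt (zero X Y n) = Y" "deg (zero X Y n) = n"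
  "src (ident X) = X" "tgt (ident X) = X" "deg (ident X) = 0"
  "src (D f) = src f" "tgt (D f) = tgt f" "deg (D f) = deg f + \<delta>"
  "src (sign i f) = src f" "tgt (sign i f) = tgt f" "deg (sign i f) = deg f"
  by (auto simp: comp_def plus_def neg_def zero_def ident_def D_def sign_def)

lemma valid_comp [simp]: "\<lbrakk>valid g; valid f; src g = tgt f\<rbrakk> \<Longrightarrow> valid (g \<bullet> f)"
  using Cmp_mor[of "src f" "tgt f" "tgt g" "val f" "deg f" "val g" "deg g"]
  by (auto simp: valid_def comp_def)

lemma valid_plus [simp]:
  "\<lbrakk>valid f; valid g; src f = src g; tgt f = tgt g; deg f = deg g\<rbrakk> \<Longrightarrow> valid (f \<boxplus> g)"
  using HomG_group[of "src f" "tgt f" "deg f"]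
  by (auto simp: valid_def plus_def abelian_group_def intro!: abelian_monoid.a_closed)

lemma valid_neg [simp]: "valid f \<Longrightarrow> valid (\<boxminus> f)"
  by (auto simp: valid_def neg_def intro!: abelian_group.a_inv_closed HomG_group)

lemma valid_zero [simp]: "\<lbrakk>X \<in> Obj A; Y \<in> Obj A\<rbrakk> \<Longrightarrow> valid (zero X Y n)"
  using HomG_group[of X Y n]
  by (auto simp: valid_def zero_def abelian_group_def intro!: abelian_monoid.zero_closed)

lemma valid_ident [simp]: "X \<in> Obj A \<Longrightarrow> valid (ident X)"
  by (auto simp: valid_def ident_def Idm_mor)

lemma valid_D [simp]: "valid f \<Longrightarrow> valid (D f)"
  using Dif_hom[of "src f" "tgt f" "deg f"] by (auto simp: valid_def D_def hom_def)

lemma valid_sign [simp]: "valid f \<Longrightarrow> valid (sign i f)"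
  by (simp add: sign_def)

lemma plus_assoc [simp]:
  "\<lbrakk>valid f; valid g; valid h; src f = src g; tgt f = tgt g; deg f = deg g;
    src g = src h; tgt g = tgt h; deg g = deg h\<rbrakk> \<Longrightarrow> f \<boxplus> g \<boxplus> h = f \<boxplus> (g \<boxplus> h)"
  using HomG_group[of "src f" "tgt f" "deg f"]
  by (auto simp: valid_def plus_def abelian_group_def intro!: abelian_monoid.a_assoc)

lemma plus_commute:
  "\<lbrakk>valid f; valid g; src f = src g; tgt f = tgt g; deg f = deg g\<rbrakk> \<Longrightarrow> f \<boxplus> g = g \<boxplus> f"
  using HomG_group[of "src f" "tgt f" "deg f"]
  by (auto simp: valid_def plus_def abelian_group_def intro!: abelian_monoid.a_comm)

lemma plus_zero_left [simp]:
  "\<lbrakk>valid f; X = src f; Y = tgt f; n = deg f\<rbrakk> \<Longrightarrow> zero X Y n \<boxplus> f = f"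
  using HomG_group[of "src f" "tgt f" "deg f"]
  by (cases f) (auto simp: valid_def plus_def zero_def abelian_group_def abelian_monoid.l_zero)

lemma plus_neg [simp]: "valid f \<Longrightarrow> f \<boxplus> \<boxminus> f = zero (src f) (tgt f) (deg f)"
  using HomG_group[of "src f" "tgt f" "deg f"]
  by (auto simp: valid_def plus_def neg_def zero_def abelian_group.r_neg)

lemma comp_assoc [simp]:
  "\<lbrakk>valid f; valid g; valid h; src h = tgt g; src g = tgt f\<rbrakk> \<Longrightarrow> (h \<bullet> g) \<bullet> f = h \<bullet> g \<bullet> f"
  using Cmp_assoc[of "src f" "tgt f" "tgt g" "tgt h" "val f" "deg f" "val g" "deg g" "val h" "deg h"]
  by (auto simp: valid_def comp_def add.assoc)

lemma comp_ident_left [simp]: "\<lbrakk>valid f; X = tgt f\<rbrakk> \<Longrightarrow> ident X \<bullet> f = f"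
  using Cmp_Idm_left[of "src f" "tgt f" "val f" "deg f"]
  by (cases f) (auto simp: valid_def comp_def ident_def)

lemma comp_ident_right [simp]: "\<lbrakk>valid f; X = src f\<rbrakk> \<Longrightarrow> f \<bullet> ident X = f"
  using Cmp_Idm_right[of "src f" "tgt f" "val f" "deg f"]
  by (cases f) (auto simp: valid_def comp_def ident_def)

lemma comp_plus_left [simp]:
  "\<lbrakk>valid f; valid g; valid h; src g = src h; tgt g = tgt h; deg g = deg h; src g = tgt f\<rbrakk>
    \<Longrightarrow> (g \<boxplus> h) \<bullet> f = g \<bullet> f \<boxplus> h \<bullet> f"
  using Cmp_add_left[of "src f" "tgt f" "tgt g" "val f" "deg f" "val g" "deg g" "val h"]
  by (auto simp: valid_def comp_def plus_def)

lemma comp_plus_right [simp]: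
  "\<lbrakk>valid f; valid g; valid h; src f = src g; tgt f = tgt g; deg f = deg g; src h = tgt f\<rbrakk>
    \<Longrightarrow> h \<bullet> (f \<boxplus> g) = h \<bullet> f \<boxplus> h \<bullet> g"
  using Cmp_add_right[of "src f" "tgt f" "tgt h" "val f" "deg f" "val g" "val h" "deg h"]
  by (auto simp: valid_def comp_def plus_def)

lemma D_plus [simp]:
  "\<lbrakk>valid f; valid g; src f = src g; tgt f = tgt g; deg f = deg g\<rbrakk> \<Longrightarrow> D (f \<boxplus> g) = D f \<boxplus> D g"
  using Dif_hom[of "src f" "tgt f" "deg f"] by (auto simp: valid_def D_def plus_def hom_def)

lemma D_D [simp]: "valid f \<Longrightarrow> D (D f) = zero (src f) (tgt f) (deg f + \<delta> + \<delta>)"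
  using Hom_complex[of "src f" "tgt f"] by (auto simp: valid_def D_def zero_def cochain_complex_def)

lemma D_comp [simp]:
  "\<lbrakk>valid f; valid g; src g = tgt f\<rbrakk> \<Longrightarrow> D (g \<bullet> f) = D g \<bullet> f \<boxplus> sign (deg g) (g \<bullet> D f)"
  using Leibniz[of "src f" "tgt f" "tgt g" "val f" "deg f" "val g" "deg g"]
  by (auto simp: valid_def D_def comp_def plus_def sign_def neg_def koszul_def ac_simps)

lemma valid_src [simp]: "valid f \<Longrightarrow> src f \<in> Obj A"
  and valid_tgt [simp]: "valid f \<Longrightarrow> tgt f \<in> Obj A"
  by (auto simp: valid_def)

lemma plus_left_commute:
  "\<lbrakk>valid f; valid g; valid h; src f = src g; tgt f = tgt g; deg f = deg g;
    src g = src h; tgt g = tgt h; deg g = deg h\<rbrakk> \<Longrightarrow> f \<boxplus> (g \<boxplus> h) = g \<boxplus> (f \<boxplus> h)"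
  by (metis plus_assoc plus_commute)

lemma plus_zero_right [simp]:
  "\<lbrakk>valid f; X = src f; Y = tgt f; n = deg f\<rbrakk> \<Longrightarrow> f \<boxplus> zero X Y n = f"
  by (simp add: plus_commute[of f])

lemma neg_plus_self [simp]: "valid f \<Longrightarrow> \<boxminus> f \<boxplus> f = zero (src f) (tgt f) (deg f)"
  by (simp add: plus_commute[of "\<boxminus> f" f])

lemma plus_neg_cancel [simp]:
  "\<lbrakk>valid f; valid g; src f = src g; tgt f = tgt g; deg f = deg g\<rbrakk> \<Longrightarrow> f \<boxplus> (\<boxminus> f \<boxplus> g) = g"
  by (simp flip: plus_assoc)

lemma neg_plus_cancel [simp]:
  "\<lbrakk>valid f; valid g; src f = src g; tgt f = tgt g; deg f = deg g\<rbrakk> \<Longrightarrow> \<boxminus> f \<boxplus> (f \<boxplus> g) = g"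
  by (simp flip: plus_assoc)

lemma plus_right_cancel:
  "\<lbrakk>valid f; valid g; valid h; src f = src h; tgt f = tgt h; deg f = deg h;
    src g = src h; tgt g = tgt h; deg g = deg h; f \<boxplus> h = g \<boxplus> h\<rbrakk> \<Longrightarrow> f = g"
  by (metis arrow_proj(7-9) plus_assoc plus_neg plus_zero_right valid_neg)

lemma neg_unique:
  "\<lbrakk>valid f; valid g; src f = src g; tgt f = tgt g; deg f = deg g;
    f \<boxplus> g = zero (src g) (tgt g) (deg g)\<rbrakk> \<Longrightarrow> f = \<boxminus> g"
  by (rule plus_right_cancel[of _ _ g]) auto

lemma neg_neg [simp]: "valid f \<Longrightarrow> \<boxminus> (\<boxminus> f) = f"
  by (rule neg_unique[symmetric]) auto

lemma neg_zero [simp]: "\<lbrakk>X \<in> Obj A; Y \<in> Obj A\<rbrakk> \<Longrightarrow> \<boxminus> (zero X Y n) = zero X Y n"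
  by (rule neg_unique[symmetric]) auto

lemma neg_plus [simp]:
  "\<lbrakk>valid f; valid g; src f = src g; tgt f = tgt g; deg f = deg g\<rbrakk> \<Longrightarrow> \<boxminus> (f \<boxplus> g) = \<boxminus> f \<boxplus> \<boxminus> g"
  by (rule neg_unique[symmetric]) (auto simp: plus_left_commute[of "\<boxminus> g" f g])

text \<open>
  Rewriting with commutativity sorts the terms of a sum by an ordering that need not put \<open>f\<close> next to
  \<open>- f\<close>; these forms of cancellation cover sums in which up to two terms stand between them.
\<close>

lemma plus_neg_cancel_distant:
  "\<lbrakk>valid f; valid g; src f = src g; tgt f = tgt g; deg f = deg g\<rbrakk> \<Longrightarrow> f \<boxplus> (g \<boxplus> \<boxminus> f) = g"
  "\<lbrakk>valid f; valid g; src f = src g; tgt f = tgt g; deg f = deg g\<rbrakk> \<Longrightarrow> \<boxminus> f \<boxplus> (g \<boxplus> f) = g"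
  "\<lbrakk>valid f; valid g; valid h; src f = src g; tgt f = tgt g; deg f = deg g;
    src g = src h; tgt g = tgt h; deg g = deg h\<rbrakk> \<Longrightarrow> f \<boxplus> (g \<boxplus> (\<boxminus> f \<boxplus> h)) = g \<boxplus> h"
  "\<lbrakk>valid f; valid g; valid h; src f = src g; tgt f = tgt g; deg f = deg g;
    src g = src h; tgt g = tgt h; deg g = deg h\<rbrakk> \<Longrightarrow> \<boxminus> f \<boxplus> (g \<boxplus> (f \<boxplus> h)) = g \<boxplus> h"
  "\<lbrakk>valid f; valid g; valid h; src f = src g; tgt f = tgt g; deg f = deg g;
    src g = src h; tgt g = tgt h; deg g = deg h\<rbrakk> \<Longrightarrow> f \<boxplus> (g \<boxplus> (h \<boxplus> \<boxminus> f)) = g \<boxplus> h"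
  "\<lbrakk>valid f; valid g; valid h; src f = src g; tgt f = tgt g; deg f = deg g;
    src g = src h; tgt g = tgt h; deg g = deg h\<rbrakk> \<Longrightarrow> \<boxminus> f \<boxplus> (g \<boxplus> (h \<boxplus> f)) = g \<boxplus> h"
  by (simp_all add: plus_left_commute[of f g] plus_left_commute[of "\<boxminus> f" g]
      plus_left_commute[of f h] plus_left_commute[of "\<boxminus> f" h])

lemmas plus_ac = plus_commute plus_left_commute plus_neg_cancel_distant

lemma plus_self_zero:
  "\<lbrakk>valid f; f \<boxplus> f = f\<rbrakk> \<Longrightarrow> f = zero (src f) (tgt f) (deg f)"
  by (rule plus_right_cancel[of _ _ f]) auto

lemma comp_zero_left [simp]:
  assumes "valid f" "X = tgt f" "Y \<in> Obj A"
  shows "zero X Y n \<bullet> f = zero (src f) Y (n + deg f)"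
  using plus_self_zero[of "zero X Y n \<bullet> f"] assms by (simp flip: comp_plus_left)

lemma comp_zero_right [simp]:
  assumes "valid f" "Y = src f" "X \<in> Obj A"
  shows "f \<bullet> zero X Y n = zero X (tgt f) (deg f + n)"
  using plus_self_zero[of "f \<bullet> zero X Y n"] assms by (simp flip: comp_plus_right)

lemma comp_neg_left [simp]: "\<lbrakk>valid f; valid g; src g = tgt f\<rbrakk> \<Longrightarrow> \<boxminus> g \<bullet> f = \<boxminus> (g \<bullet> f)"
  by (rule neg_unique) (auto simp flip: comp_plus_left)

lemma comp_neg_right [simp]: "\<lbrakk>valid f; valid g; src g = tgt f\<rbrakk> \<Longrightarrow> g \<bullet> \<boxminus> f = \<boxminus> (g \<bullet> f)"
  by (rule neg_unique) (auto simp flip: comp_plus_right)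

lemma D_zero [simp]: "\<lbrakk>X \<in> Obj A; Y \<in> Obj A\<rbrakk> \<Longrightarrow> D (zero X Y n) = zero X Y (n + \<delta>)"
  using plus_self_zero[of "D (zero X Y n)"] by (simp flip: D_plus)

lemma D_neg [simp]: "valid f \<Longrightarrow> D (\<boxminus> f) = \<boxminus> (D f)"
  by (rule neg_unique) (auto simp flip: D_plus)

lemma D_ident [simp]: "X \<in> Obj A \<Longrightarrow> D (ident X) = zero X X \<delta>"
  using Idm_closed[of X] by (auto simp: D_def zero_def ident_def)

lemma valid_Arrow:
  "\<lbrakk>X \<in> Obj A; Y \<in> Obj A\<rbrakk> \<Longrightarrow> valid (Arrow X Y n f) \<longleftrightarrow> f \<in> mor A X Y n"
  by (simp add: valid_def)

lemma arrow_eqI: "\<lbrakk>src f = src g; tgt f = tgt g; deg f = deg g; val f = val g\<rbrakk> \<Longrightarrow> f = g"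
  by (cases f; cases g) auto

lemma val_simps:
  "val (g \<bullet> f) = Cmp A (val g) (val f)"
  "val (f \<boxplus> g) = val f \<oplus>\<^bsub>HomG A (src f) (tgt f) (deg f)\<^esub> val g"
  "val (\<boxminus> f) = \<ominus>\<^bsub>HomG A (src f) (tgt f) (deg f)\<^esub> val f"
  "val (zero X Y n) = \<zero>\<^bsub>HomG A X Y n\<^esub>"
  "val (ident X) = Idm A X"
  "val (D f) = Dif A (src f) (tgt f) (deg f) (val f)"
  "val (sign i f) = koszul \<Gamma> (HomG A (src f) (tgt f) (deg f)) i (val f)"
  by (auto simp: comp_def plus_def neg_def zero_def ident_def D_def sign_def koszul_def)

lemma closed_mor_iff:
  assumes "X \<in> Obj A" "Y \<in> Obj A"
  shows "f \<in> closed_mor \<Gamma> A X Y n \<longleftrightarrow>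
    valid (Arrow X Y n f) \<and> D (Arrow X Y n f) = zero X Y (n + \<delta>)"
  using assms by (simp add: closed_mor_def valid_Arrow D_def zero_def)

text \<open>
  Composites are kept nested to the right, so an equation for a composite of two morphisms does not
  match inside a longer one. This form of associativity supplies the variant with a further factor.
\<close>

lemma comp_reassoc:
  "\<lbrakk>h \<bullet> g = k; valid f; valid g; valid h; src h = tgt g; src g = tgt f\<rbrakk> \<Longrightarrow> h \<bullet> g \<bullet> f = k \<bullet> f"
  by (metis comp_assoc)

lemma parity_cases: obtains "parity \<Gamma> k i = 0" | "parity \<Gamma> k i = 1"
  by (cases "parity \<Gamma> k i") auto

definition arr :: "('g, 'o, 'm) arrow \<Rightarrow> 'o \<Rightarrow> 'o \<Rightarrow> 'g \<Rightarrow> bool" where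
  "arr f X Y n \<longleftrightarrow> X \<in> Obj A \<and> Y \<in> Obj A \<and> valid f \<and> src f = X \<and> tgt f = Y \<and> deg f = n"

lemma arr_Arrow: "\<lbrakk>X \<in> Obj A; Y \<in> Obj A; f \<in> mor A X Y n\<rbrakk> \<Longrightarrow> arr (Arrow X Y n f) X Y n"
  by (simp add: arr_def valid_Arrow)

lemmas degree_simps = parity_simps plus_ac add.commute add.left_commute sign_def

section \<open>Graded commutators\<close>

text \<open>
  The graded commutator with a pair of endomorphisms \<open>s\<close> and \<open>t\<close> of the source and the target. With
  degree \<open>-1\<close> endomorphisms it is the differential of \<open>A\<^sup>\<natural>\<close>, so its vanishing singles out the
  morphisms of \<open>A\<^sup>\<natural>\<^sup>\<natural>\<close> among the closed morphisms of \<open>A\<close>; with degree \<open>1\<close> endomorphisms it is the differential of \<open>A\<^sup>\<natural>\<^sup>\<natural>\<close>.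
\<close>

definition bracket where
  "bracket t s f = t \<bullet> f \<boxplus> \<boxminus> (sign (deg f) (f \<bullet> s))"

lemma bracket_proj [simp]:
  "src (bracket t s f) = src f" "tgt (bracket t s f) = tgt t" "deg (bracket t s f) = deg t + deg f"
  by (simp_all add: bracket_def)

lemma bracket_arr:
  assumes "arr s X X k" "arr t Y Y k" "arr f X Y n"
  shows "arr (bracket t s f) X Y (k + n)"
  using assms by (auto simp add: arr_def bracket_def add.commute)

lemma bracket_plus:
  assumes "arr s X X k" "arr t Y Y k" "arr f X Y n" "arr g X Y n"
  shows "bracket t s (f \<boxplus> g) = bracket t s f \<boxplus> bracket t s g"
  using assms by (simp add: arr_def bracket_def degree_simps)

lemma bracket_ident: "arr s X X k \<Longrightarrow> bracket s s (ident X) = zero X X k"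
  by (simp add: arr_def bracket_def sign_def)

text \<open>
  The two mixed terms \<open>t f s\<close> have opposite signs since \<open>s\<close> and \<open>t\<close> are odd.
\<close>

lemma bracket_bracket:
  assumes "arr s X X k" "arr t Y Y k" "arr f X Y n" and k: "parity \<Gamma> \<delta> k = 1"
    and s: "s \<bullet> s = zero X X (k + k)" and t: "t \<bullet> t = zero Y Y (k + k)"
  shows "bracket t s (bracket t s f) = zero X Y (k + (k + n))"
proof -
  note [simp] = assms(1-3)[unfolded arr_def] k s comp_reassoc[OF t, of f]
  show ?thesis
    by (cases rule: parity_cases[of \<delta> n]) (simp_all add: bracket_def degree_simps)
qed

lemma bracket_comp:
  assumes "arr s X X k" "arr t Y Y k" "arr u Z Z k" "arr f X Y i" "arr g Y Z j"
  shows "bracket u s (g \<bullet> f) = bracket u t g \<bullet> f \<boxplus> sign j (g \<bullet> bracket t s f)"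
  using assms
  by (cases rule: parity_cases[of \<delta> i]; cases rule: parity_cases[of \<delta> j])
     (simp_all add: arr_def bracket_def degree_simps)

text \<open>
  By the Leibniz rule, \<open>D (t f) = f\<close> and \<open>D (f s) = (-1)^n f\<close>, and the sign in the bracket makes these
  cancel. This is why the differential of \<open>A\<^sup>\<natural>\<close> takes closed morphisms to closed morphisms.
\<close>

lemma bracket_closed:
  assumes "arr s X X (- \<delta>)" "arr t Y Y (- \<delta>)" "arr f X Y n"
    "D s = ident X" "D t = ident Y" "D f = zero X Y (n + \<delta>)"
  shows "D (bracket t s f) = zero X Y n"
  using assms
  by (cases rule: parity_cases[of \<delta> n]) (simp_all add: arr_def bracket_def degree_simps)

section \<open>Closed morphisms\<close>

definition closed_arr :: "('g, 'o, 'm) arrow \<Rightarrow> 'o \<Rightarrow> 'o \<Rightarrow> 'g \<Rightarrow> bool" where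
  "closed_arr f X Y n \<longleftrightarrow> arr f X Y n \<and> D f = zero X Y (n + \<delta>)"

lemma closed_mor_iff_arr:
  assumes "X \<in> Obj A" "Y \<in> Obj A"
  shows "f \<in> closed_mor \<Gamma> A X Y n \<longleftrightarrow> closed_arr (Arrow X Y n f) X Y n"
  using assms by (simp add: closed_mor_iff closed_arr_def arr_def)

lemma closed_mor_val: "closed_arr f X Y n \<Longrightarrow> val f \<in> closed_mor \<Gamma> A X Y n"
  by (cases f) (auto simp: closed_arr_def closed_mor_iff arr_def)

lemma closed_arr_comp: "\<lbrakk>closed_arr f X Y i; closed_arr g Y Z j\<rbrakk> \<Longrightarrow> closed_arr (g \<bullet> f) X Z (j + i)"
  by (auto simp: closed_arr_def arr_def sign_def ac_simps)

lemma closed_arr_plus: "\<lbrakk>closed_arr f X Y i; closed_arr g X Y i\<rbrakk> \<Longrightarrow> closed_arr (f \<boxplus> g) X Y i"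
  by (auto simp: closed_arr_def arr_def)

lemma closed_arr_neg: "closed_arr f X Y i \<Longrightarrow> closed_arr (\<boxminus> f) X Y i"
  by (auto simp: closed_arr_def arr_def)

lemma closed_arr_zero: "\<lbrakk>X \<in> Obj A; Y \<in> Obj A\<rbrakk> \<Longrightarrow> closed_arr (zero X Y i) X Y i"
  by (auto simp: closed_arr_def arr_def)

lemma closed_arr_ident: "X \<in> Obj A \<Longrightarrow> closed_arr (ident X) X X 0"
  by (auto simp: closed_arr_def arr_def)

lemma closed_group:
  assumes [simp]: "X \<in> Obj A" "Y \<in> Obj A"
  shows "abelian_group ((HomG A X Y n)\<lparr>carrier := closed_mor \<Gamma> A X Y n\<rparr>)"
proof -
  interpret G: abelian_group "HomG A X Y n" by (rule HomG_group) fact+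
  have sub: "x \<in> mor A X Y n" if "x \<in> closed_mor \<Gamma> A X Y n" for x
    using that by (simp add: closed_mor_def)
  have plus: "x \<oplus>\<^bsub>HomG A X Y n\<^esub> y \<in> closed_mor \<Gamma> A X Y n"
    if "x \<in> closed_mor \<Gamma> A X Y n" "y \<in> closed_mor \<Gamma> A X Y n" for x y
    using closed_mor_val[OF closed_arr_plus, of "Arrow X Y n x" X Y n "Arrow X Y n y"] that
    by (simp add: closed_mor_iff_arr val_simps)
  have neg: "\<ominus>\<^bsub>HomG A X Y n\<^esub> x \<in> closed_mor \<Gamma> A X Y n" if "x \<in> closed_mor \<Gamma> A X Y n" for x
    using closed_mor_val[OF closed_arr_neg, of "Arrow X Y n x" X Y n] that
    by (simp add: closed_mor_iff_arr val_simps)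
  have zero: "\<zero>\<^bsub>HomG A X Y n\<^esub> \<in> closed_mor \<Gamma> A X Y n"
    using closed_mor_val[OF closed_arr_zero, of X Y n] by (simp add: val_simps)
  show ?thesis
    by (rule abelian_groupI)
       (auto simp: plus zero sub G.a_ac G.r_neg intro!: bexI[of _ "\<ominus>\<^bsub>HomG A X Y n\<^esub> _"] neg)
qed

text \<open>
  The negative of an element is defined relative to the carrier, which \<open>A\<^sup>\<natural>\<close> restricts to the closed
  morphisms; the signs in the differential of \<open>A\<^sup>\<natural>\<^sup>\<natural>\<close> involve this restricted negative.
\<close>

lemma closed_group_neg:
  assumes "X \<in> Obj A" "Y \<in> Obj A" "f \<in> closed_mor \<Gamma> A X Y n"
  shows "\<ominus>\<^bsub>(HomG A X Y n)\<lparr>carrier := closed_mor \<Gamma> A X Y n\<rparr>\<^esub> f = \<ominus>\<^bsub>HomG A X Y n\<^esub> f"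
proof -
  interpret G: abelian_group "HomG A X Y n" by (rule HomG_group) fact+
  interpret Z: abelian_group "(HomG A X Y n)\<lparr>carrier := closed_mor \<Gamma> A X Y n\<rparr>"
    by (rule closed_group) fact+
  show ?thesis
    using Z.a_inv_closed[of f] Z.l_neg[of f] G.minus_equality[of _ f] assms(3)
    by (simp add: closed_mor_def)
qed

section \<open>The DG-category of objects with a contraction\<close>

lemma nat_dg_simps [simp]:
  "Cmp (nat_dg \<Gamma> A) = Cmp A"
  "Idm (nat_dg \<Gamma> A) P = Idm A (fst P)"
  "HomG (nat_dg \<Gamma> A) P Q i =
    (HomG A (fst P) (fst Q) (- i))\<lparr>carrier := closed_mor \<Gamma> A (fst P) (fst Q) (- i)\<rparr>"
  by (auto simp: nat_dg_def split_beta)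

definition sigma_arr :: "'o \<times> 'm \<Rightarrow> ('g, 'o, 'm) arrow" where
  "sigma_arr P = Arrow (fst P) (fst P) (- \<delta>) (snd P)"

lemma nat_dg_Obj_iff:
  "P \<in> Obj (nat_dg \<Gamma> A) \<longleftrightarrow>
    arr (sigma_arr P) (fst P) (fst P) (- \<delta>) \<and> D (sigma_arr P) = ident (fst P) \<and>
    sigma_arr P \<bullet> sigma_arr P = zero (fst P) (fst P) (- \<delta> + - \<delta>)"
  by (cases P)
     (auto simp: nat_dg_def sigma_arr_def arr_def valid_def D_def ident_def comp_def zero_def)

lemma nat_dg_Obj_fst: "P \<in> Obj (nat_dg \<Gamma> A) \<Longrightarrow> fst P \<in> Obj A"
  by (simp add: nat_dg_Obj_iff arr_def)

lemma nat_dg_Dif: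
  "Dif (nat_dg \<Gamma> A) P Q i f =
    val (bracket (sigma_arr Q) (sigma_arr P) (Arrow (fst P) (fst Q) (- i) f))"
  by (simp add: nat_dg_def split_beta bracket_def sigma_arr_def val_simps a_minus_def koszul_def
    add.commute del: add_uminus_conv_diff)

lemma nat_dg_Dif_closed:
  assumes "P \<in> Obj (nat_dg \<Gamma> A)" "Q \<in> Obj (nat_dg \<Gamma> A)"
    and "closed_arr f (fst P) (fst Q) (- i)"
  shows "closed_arr (bracket (sigma_arr Q) (sigma_arr P) f) (fst P) (fst Q) (- (i + \<delta>))"
  using assms bracket_arr[of "sigma_arr P" "fst P" "- \<delta>" "sigma_arr Q" "fst Q" f]
    bracket_closed[of "sigma_arr P" "fst P" "sigma_arr Q" "fst Q" f]
  by (auto simp: nat_dg_Obj_iff closed_arr_def)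

lemma nat_dg_complex:
  assumes P: "P \<in> Obj (nat_dg \<Gamma> A)" and Q: "Q \<in> Obj (nat_dg \<Gamma> A)"
  shows "cochain_complex \<Gamma> (Hom (nat_dg \<Gamma> A) P Q)"
proof -
  note [simp] = P[THEN nat_dg_Obj_fst] Q[THEN nat_dg_Obj_fst]
  let ?X = "fst P" and ?Y = "fst Q" and ?b = "bracket (sigma_arr Q) (sigma_arr P)"
  have closed: "Dif (nat_dg \<Gamma> A) P Q n f \<in> closed_mor \<Gamma> A ?X ?Y (- (n + \<delta>))"
    if "f \<in> closed_mor \<Gamma> A ?X ?Y (- n)" for f n
    using closed_mor_val[OF nat_dg_Dif_closed[OF P Q]] that
    by (simp add: nat_dg_Dif closed_mor_iff_arr)
  have add: "Dif (nat_dg \<Gamma> A) P Q n (f \<oplus>\<^bsub>HomG A ?X ?Y (- n)\<^esub> g) =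
      Dif (nat_dg \<Gamma> A) P Q n f \<oplus>\<^bsub>HomG A ?X ?Y (- (n + \<delta>))\<^esub> Dif (nat_dg \<Gamma> A) P Q n g"
    if "f \<in> closed_mor \<Gamma> A ?X ?Y (- n)" "g \<in> closed_mor \<Gamma> A ?X ?Y (- n)" for f g n
  proof -
    have "?b (Arrow ?X ?Y (- n) f \<boxplus> Arrow ?X ?Y (- n) g) =
        ?b (Arrow ?X ?Y (- n) f) \<boxplus> ?b (Arrow ?X ?Y (- n) g)"
      using P Q that by (intro bracket_plus) (auto simp: nat_dg_Obj_iff closed_mor_iff_arr closed_arr_def)
    from arg_cong[OF this, of val] show ?thesis
      by (simp add: nat_dg_Dif val_simps plus_def sigma_arr_def add.commute
        del: add_uminus_conv_diff)
  qed
  have zero: "Dif (nat_dg \<Gamma> A) P Q (n + \<delta>) (Dif (nat_dg \<Gamma> A) P Q n f) =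
      \<zero>\<^bsub>HomG A ?X ?Y (- (n + \<delta> + \<delta>))\<^esub>"
    if "f \<in> closed_mor \<Gamma> A ?X ?Y (- n)" for f n
  proof -
    have "?b (?b (Arrow ?X ?Y (- n) f)) = zero ?X ?Y (- \<delta> + (- \<delta> + - n))"
      using P Q that
      by (intro bracket_bracket) (auto simp: nat_dg_Obj_iff closed_mor_iff_arr closed_arr_def parity_deg1)
    moreover have "Arrow ?X ?Y (- (n + \<delta>)) (val (?b (Arrow ?X ?Y (- n) f))) = ?b (Arrow ?X ?Y (- n) f)"
      by (rule arrow_eqI) (simp_all add: sigma_arr_def)
    ultimately show ?thesis
      by (simp only: nat_dg_Dif val_simps minus_add_distrib ac_simps)
  qed
  show ?thesis
    unfolding cochain_complex_def using closed add zero
    by (auto simp: hom_def closed_group)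
qed

theorem nat_dg_category: "dg_category \<Gamma> (nat_dg \<Gamma> A)"
proof (intro dg_category.intro dg_category_axioms.intro grading_axioms, goal_cases)
  case 1
  then show ?case by (rule nat_dg_complex)
next
  case (2 P)
  then show ?case
    using closed_mor_val[OF closed_arr_ident[of "fst P"]] by (simp add: nat_dg_Obj_fst val_simps)
next
  case (3 P)
  then show ?case
    using bracket_ident[of "sigma_arr P" "fst P" "- \<delta>"]
    by (simp add: nat_dg_Dif nat_dg_Obj_iff ident_def zero_def)
next
  case (4 P Q R f i g j)
  then show ?case
    using closed_mor_val[OF closed_arr_comp, of "Arrow (fst P) (fst Q) (- i) f" "fst P" "fst Q" "- i"
      "Arrow (fst Q) (fst R) (- j) g" "fst R" "- j"]
    by (simp add: nat_dg_Obj_fst closed_mor_iff_arr val_simps)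
next
  case (5 P Q R f i g j g')
  then show ?case
    using Cmp_add_left[of "fst P" "fst Q" "fst R" f "- i" g "- j" g']
    by (simp add: nat_dg_Obj_fst closed_mor_def)
next
  case (6 P Q R f i f' g j)
  then show ?case
    using Cmp_add_right[of "fst P" "fst Q" "fst R" f "- i" f' g "- j"]
    by (simp add: nat_dg_Obj_fst closed_mor_def)
next
  case (7 P Q R S f i g j h k)
  then show ?case
    using Cmp_assoc[of "fst P" "fst Q" "fst R" "fst S" f "- i" g "- j" h "- k"]
    by (simp add: nat_dg_Obj_fst closed_mor_def)
next
  case (8 P Q f i)
  then show ?case
    using Cmp_Idm_left[of "fst P" "fst Q" f "- i"] by (simp add: nat_dg_Obj_fst closed_mor_def)
next
  case (9 P Q f i)
  then show ?case
    using Cmp_Idm_right[of "fst P" "fst Q" f "- i"] by (simp add: nat_dg_Obj_fst closed_mor_def)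
next
  case (10 P Q R f i g j)
  let ?X = "fst P" and ?Y = "fst Q" and ?Z = "fst R"
  let ?f = "Arrow ?X ?Y (- i) f" and ?g = "Arrow ?Y ?Z (- j) g"
  let ?df = "bracket (sigma_arr Q) (sigma_arr P) ?f"
  have f: "closed_arr ?f ?X ?Y (- i)" and g: "closed_arr ?g ?Y ?Z (- j)"
    using 10 by (auto simp: nat_dg_Obj_fst closed_mor_iff_arr)
  have "closed_arr (?g \<bullet> ?df) ?X ?Z (- j + - (i + \<delta>))"
    using closed_arr_comp[OF nat_dg_Dif_closed g] 10 f by simp
  from closed_mor_val[OF this]
  have closed: "Cmp A g (val ?df) \<in> closed_mor \<Gamma> A ?X ?Z (- (j + i + \<delta>))"
    by (simp add: val_simps algebra_simps)
  have "bracket (sigma_arr R) (sigma_arr P) (?g \<bullet> ?f) =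
      bracket (sigma_arr R) (sigma_arr Q) ?g \<bullet> ?f \<boxplus> sign (- j) (?g \<bullet> ?df)"
    using 10 f g by (intro bracket_comp) (auto simp: nat_dg_Obj_iff closed_arr_def)
  from arg_cong[OF this, of val] closed 10 show ?case
    by (simp add: nat_dg_Dif val_simps koszul_def closed_group_neg nat_dg_Obj_fst sigma_arr_def comp_def algebra_simps)
qed

section \<open>The morphisms of the iterated construction\<close>

definition tau_arr :: "('o \<times> 'm) \<times> 'm \<Rightarrow> ('g, 'o, 'm) arrow" where
  "tau_arr P = Arrow (fst (fst P)) (fst (fst P)) \<delta> (snd P)"

lemma sigma_arr_proj [simp]:
  "src (sigma_arr P) = fst P" "tgt (sigma_arr P) = fst P" "deg (sigma_arr P) = - \<delta>"
  "val (sigma_arr P) = snd P"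
  by (simp_all add: sigma_arr_def)

lemma tau_arr_proj [simp]:
  "src (tau_arr P) = fst (fst P)" "tgt (tau_arr P) = fst (fst P)" "deg (tau_arr P) = \<delta>"
  "val (tau_arr P) = snd P"
  by (simp_all add: tau_arr_def)

lemma natnat_Obj_iff:
  "P \<in> Obj (nat_dg \<Gamma> (nat_dg \<Gamma> A)) \<longleftrightarrow>
    fst P \<in> Obj (nat_dg \<Gamma> A) \<and>
    closed_arr (tau_arr P) (fst (fst P)) (fst (fst P)) \<delta> \<and>
    bracket (sigma_arr (fst P)) (sigma_arr (fst P)) (tau_arr P) = ident (fst (fst P)) \<and>
    tau_arr P \<bullet> tau_arr P = zero (fst (fst P)) (fst (fst P)) (\<delta> + \<delta>)"
  (is "?l \<longleftrightarrow> ?r")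
proof -
  let ?W = "fst (fst P)" and ?s = "sigma_arr (fst P)"
  have "?l \<longleftrightarrow> fst P \<in> Obj (nat_dg \<Gamma> A) \<and> snd P \<in> closed_mor \<Gamma> A ?W ?W \<delta> \<and>
      Dif (nat_dg \<Gamma> A) (fst P) (fst P) (- \<delta>) (snd P) = Idm A ?W \<and>
      Cmp A (snd P) (snd P) = \<zero>\<^bsub>HomG A ?W ?W (\<delta> + \<delta>)\<^esub>"
    by (cases P) (simp add: nat_dg_def[of \<Gamma> "nat_dg \<Gamma> A"])
  also have "\<dots> \<longleftrightarrow> ?r"
  proof (intro conj_cong refl)
    assume "fst P \<in> Obj (nat_dg \<Gamma> A)"
    then show "snd P \<in> closed_mor \<Gamma> A ?W ?W \<delta> \<longleftrightarrow> closed_arr (tau_arr P) ?W ?W \<delta>"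
      by (simp add: nat_dg_Obj_fst closed_mor_iff_arr tau_arr_def)
  next
    have "bracket ?s ?s (tau_arr P) = ident ?W \<longleftrightarrow> val (bracket ?s ?s (tau_arr P)) = Idm A ?W"
      by (auto simp: val_simps intro: arrow_eqI)
    then show "Dif (nat_dg \<Gamma> A) (fst P) (fst P) (- \<delta>) (snd P) = Idm A ?W \<longleftrightarrow>
        bracket ?s ?s (tau_arr P) = ident ?W"
      by (simp add: nat_dg_Dif tau_arr_def)
  next
    show "Cmp A (snd P) (snd P) = \<zero>\<^bsub>HomG A ?W ?W (\<delta> + \<delta>)\<^esub> \<longleftrightarrow>
        tau_arr P \<bullet> tau_arr P = zero ?W ?W (\<delta> + \<delta>)"
      by (simp add: comp_def zero_def)
  qed
  finally show ?thesis .
qed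

text \<open>
  Morphisms of degree \<open>i\<close> in \<open>A\<^sup>\<natural>\<^sup>\<natural>\<close> are closed morphisms of degree \<open>-i\<close> in \<open>A\<^sup>\<natural>\<close>; as \<open>A\<^sup>\<natural>\<close> also negates
  degrees, they are morphisms of degree \<open>i\<close> in \<open>A\<close>.
\<close>

lemma closed_nat_dg_iff:
  assumes "P \<in> Obj (nat_dg \<Gamma> A)" "Q \<in> Obj (nat_dg \<Gamma> A)"
  shows "f \<in> closed_mor \<Gamma> (nat_dg \<Gamma> A) P Q (- i) \<longleftrightarrow>
    closed_arr (Arrow (fst P) (fst Q) i f) (fst P) (fst Q) i \<and>
    bracket (sigma_arr Q) (sigma_arr P) (Arrow (fst P) (fst Q) i f) =
      zero (fst P) (fst Q) (- \<delta> + i)"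
proof -
  let ?b = "bracket (sigma_arr Q) (sigma_arr P) (Arrow (fst P) (fst Q) i f)"
  have "val ?b = \<zero>\<^bsub>HomG A (fst P) (fst Q) (- (- i + \<delta>))\<^esub> \<longleftrightarrow>
      ?b = zero (fst P) (fst Q) (- \<delta> + i)"
    by (auto simp: val_simps intro: arrow_eqI)
  then show ?thesis
    using assms nat_dg_Obj_fst
    by (simp add: closed_mor_def[of \<Gamma> "nat_dg \<Gamma> A"] nat_dg_Dif closed_mor_iff_arr)
qed

lemma natnat_simps [simp]:
  "Cmp (nat_dg \<Gamma> (nat_dg \<Gamma> A)) = Cmp A"
  "Idm (nat_dg \<Gamma> (nat_dg \<Gamma> A)) P = Idm A (fst (fst P))"
  "mor (nat_dg \<Gamma> (nat_dg \<Gamma> A)) P Q i = closed_mor \<Gamma> (nat_dg \<Gamma> A) (fst P) (fst Q) (- i)"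
  "\<zero>\<^bsub>HomG (nat_dg \<Gamma> (nat_dg \<Gamma> A)) P Q i\<^esub> = \<zero>\<^bsub>HomG A (fst (fst P)) (fst (fst Q)) i\<^esub>"
  "f \<oplus>\<^bsub>HomG (nat_dg \<Gamma> (nat_dg \<Gamma> A)) P Q i\<^esub> g = f \<oplus>\<^bsub>HomG A (fst (fst P)) (fst (fst Q)) i\<^esub> g"
  by (auto simp: nat_dg_def split_beta)

lemma natnat_Dif:
  assumes P: "P \<in> Obj (nat_dg \<Gamma> (nat_dg \<Gamma> A))" and Q: "Q \<in> Obj (nat_dg \<Gamma> (nat_dg \<Gamma> A))"
    and f: "f \<in> mor (nat_dg \<Gamma> (nat_dg \<Gamma> A)) P Q i"
  shows "Dif (nat_dg \<Gamma> (nat_dg \<Gamma> A)) P Q i f =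
    val (bracket (tau_arr Q) (tau_arr P) (Arrow (fst (fst P)) (fst (fst Q)) i f))"
proof -
  let ?W = "fst (fst P)" and ?V = "fst (fst Q)"
  have Obj: "?W \<in> Obj A" "?V \<in> Obj A"
    using P Q by (auto simp: natnat_Obj_iff nat_dg_Obj_fst)
  have "closed_arr (Arrow ?W ?V i f \<bullet> tau_arr P) ?W ?V (i + \<delta>)"
    using P Q f by (intro closed_arr_comp[where Y = ?W]) (auto simp: natnat_Obj_iff closed_nat_dg_iff)
  from closed_mor_val[OF this]
  have fP: "Cmp A f (snd P) \<in> closed_mor \<Gamma> A ?W ?V (i + \<delta>)"
    by (simp add: val_simps)
  have neg: "\<ominus>\<^bsub>HomG A ?W ?V (i + \<delta>)\<^esub> Cmp A f (snd P) \<in> closed_mor \<Gamma> A ?W ?V (i + \<delta>)"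
    using abelian_group.a_inv_closed[OF closed_group[OF Obj], of "Cmp A f (snd P)" "i + \<delta>"] fP
    by (simp add: closed_group_neg Obj)
  have "Dif (nat_dg \<Gamma> (nat_dg \<Gamma> A)) P Q i f =
      Cmp A (snd Q) f \<oplus>\<^bsub>HomG A ?W ?V (i + \<delta>)\<^esub>
        \<ominus>\<^bsub>HomG A ?W ?V (i + \<delta>)\<^esub> koszul \<Gamma> (HomG A ?W ?V (i + \<delta>)) i (Cmp A f (snd P))"
    using fP neg
    by (simp add: nat_dg_def[of \<Gamma> "nat_dg \<Gamma> A"] split_beta a_minus_def koszul_def closed_group_neg Obj
        add.commute[of i \<delta>])
  then show ?thesis
    by (simp add: bracket_def val_simps add.commute)
qed

section \<open>The functor on morphisms\<close>

definition inc :: "('o, 'm) cone_choice \<Rightarrow> 'o \<Rightarrow> ('g, 'o, 'm) arrow" where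
  "inc c X = Arrow X (cE c X) \<delta> (c\<iota> c X)"
definition prj :: "('o, 'm) cone_choice \<Rightarrow> 'o \<Rightarrow> ('g, 'o, 'm) arrow" where
  "prj c X = Arrow (cE c X) X 0 (c\<pi> c X)"
definition inc' :: "('o, 'm) cone_choice \<Rightarrow> 'o \<Rightarrow> ('g, 'o, 'm) arrow" where
  "inc' c X = Arrow X (cE c X) 0 (c\<iota>' c X)"
definition prj' :: "('o, 'm) cone_choice \<Rightarrow> 'o \<Rightarrow> ('g, 'o, 'm) arrow" where
  "prj' c X = Arrow (cE c X) X (- \<delta>) (c\<pi>' c X)"

text \<open>
  Since this involves only the values of the choice at \<open>X\<close> and does not ask that the object \<open>cE c X\<close>
  represent a cone, it applies also to the objects of \<open>A\<^sup>\<natural>\<^sup>\<natural>\<close> that are to be recognized as cones.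
\<close>

definition cone_data :: "('o, 'm) cone_choice \<Rightarrow> 'o \<Rightarrow> bool" where
  "cone_data c X \<longleftrightarrow>
    closed_arr (inc c X) X (cE c X) \<delta> \<and> closed_arr (prj c X) (cE c X) X 0 \<and>
    arr (prj' c X) (cE c X) X (- \<delta>) \<and> arr (inc' c X) X (cE c X) 0 \<and>
    prj' c X \<bullet> inc' c X = zero X X (- \<delta>) \<and> prj c X \<bullet> inc c X = zero X X \<delta> \<and>
    prj' c X \<bullet> inc c X = ident X \<and> prj c X \<bullet> inc' c X = ident X \<and>
    inc c X \<bullet> prj' c X \<boxplus> inc' c X \<bullet> prj c X = ident (cE c X) \<and>
    D (prj' c X) = prj c X \<and> D (inc' c X) = inc c X"

lemma cone_data_iff:
  assumes "X \<in> Obj A" "cE c X \<in> Obj A"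
  shows "cone_data c X \<longleftrightarrow>
    (let E = cE c X; \<iota> = c\<iota> c X; \<pi> = c\<pi> c X; \<iota>' = c\<iota>' c X; \<pi>' = c\<pi>' c X in
        \<iota> \<in> closed_mor \<Gamma> A X E (deg1 \<Gamma>) \<and> \<pi> \<in> closed_mor \<Gamma> A E X 0 \<and>
        \<pi>' \<in> mor A E X (- deg1 \<Gamma>) \<and> \<iota>' \<in> mor A X E 0 \<and>
        Cmp A \<pi>' \<iota>' = \<zero>\<^bsub>HomG A X X (- deg1 \<Gamma>)\<^esub> \<and> Cmp A \<pi> \<iota> = \<zero>\<^bsub>HomG A X X (deg1 \<Gamma>)\<^esub> \<and>
        Cmp A \<pi>' \<iota> = Idm A X \<and> Cmp A \<pi> \<iota>' = Idm A X \<and>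
        Cmp A \<iota> \<pi>' \<oplus>\<^bsub>HomG A E E 0\<^esub> Cmp A \<iota>' \<pi> = Idm A E \<and>
        Dif A E X (- deg1 \<Gamma>) \<pi>' = \<pi> \<and> Dif A X E 0 \<iota>' = \<iota>)"
  using assms
  by (auto simp: cone_data_def Let_def closed_mor_iff_arr arr_def valid_def inc_def prj_def inc'_def prj'_def
    comp_def ident_def zero_def plus_def D_def)

lemma cone_dataD:
  assumes "cone_data c X"
  shows "X \<in> Obj A" "cE c X \<in> Obj A"
    "valid (inc c X)" "valid (prj c X)" "valid (inc' c X)" "valid (prj' c X)"
    "src (inc c X) = X" "src (prj c X) = cE c X" "src (inc' c X) = X" "src (prj' c X) = cE c X"
    "tgt (inc c X) = cE c X" "tgt (prj c X) = X" "tgt (inc' c X) = cE c X" "tgt (prj' c X) = X"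
    "deg (inc c X) = \<delta>" "deg (prj c X) = 0" "deg (inc' c X) = 0" "deg (prj' c X) = - \<delta>"
    "D (inc c X) = zero X (cE c X) (\<delta> + \<delta>)" "D (prj c X) = zero (cE c X) X \<delta>"
    "D (inc' c X) = inc c X" "D (prj' c X) = prj c X"
    "prj' c X \<bullet> inc' c X = zero X X (- \<delta>)" "prj c X \<bullet> inc c X = zero X X \<delta>"
    "prj' c X \<bullet> inc c X = ident X" "prj c X \<bullet> inc' c X = ident X"
    "inc c X \<bullet> prj' c X \<boxplus> inc' c X \<bullet> prj c X = ident (cE c X)"
    "inc' c X \<bullet> prj c X \<boxplus> inc c X \<bullet> prj' c X = ident (cE c X)"
  using assms plus_commute[of "inc c X \<bullet> prj' c X" "inc' c X \<bullet> prj c X"]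
  by (auto simp: cone_data_def closed_arr_def arr_def)

lemma cone_data_reassoc:
  assumes "cone_data c X" "valid f" "tgt f = X"
  shows "prj' c X \<bullet> inc' c X \<bullet> f = zero (src f) X (deg f - \<delta>)"
    "prj c X \<bullet> inc c X \<bullet> f = zero (src f) X (\<delta> + deg f)"
    "prj' c X \<bullet> inc c X \<bullet> f = f" "prj c X \<bullet> inc' c X \<bullet> f = f"
  using assms by (simp_all add: comp_reassoc[of _ _ _ f] cone_dataD[OF assms(1)])

lemmas cone_data_simps = cone_dataD cone_data_reassoc

definition cone_map ::
  "('o, 'm) cone_choice \<Rightarrow> 'o \<Rightarrow> 'o \<Rightarrow> ('g, 'o, 'm) arrow \<Rightarrow> ('g, 'o, 'm) arrow" where
  "cone_map c X Y f = sign (deg f) (inc' c Y \<bullet> f \<bullet> prj c X) \<boxplus> inc c Y \<bullet> f \<bullet> prj' c X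
    \<boxplus> inc' c Y \<bullet> D f \<bullet> prj' c X"

definition cone_sigma :: "('o, 'm) cone_choice \<Rightarrow> 'o \<Rightarrow> ('g, 'o, 'm) arrow" where
  "cone_sigma c X = inc' c X \<bullet> prj' c X"
definition cone_tau :: "('o, 'm) cone_choice \<Rightarrow> 'o \<Rightarrow> ('g, 'o, 'm) arrow" where
  "cone_tau c X = inc c X \<bullet> prj c X"

lemma cone_sigma_facts:
  assumes "cone_data c X"
  shows "arr (cone_sigma c X) (cE c X) (cE c X) (- \<delta>)"
    "D (cone_sigma c X) = ident (cE c X)"
    "cone_sigma c X \<bullet> cone_sigma c X = zero (cE c X) (cE c X) (- \<delta> + - \<delta>)"
  using assms by (simp_all add: cone_sigma_def arr_def cone_data_simps sign_def)

lemma cone_tau_facts: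
  assumes "cone_data c X"
  shows "closed_arr (cone_tau c X) (cE c X) (cE c X) \<delta>"
    "cone_tau c X \<bullet> cone_tau c X = zero (cE c X) (cE c X) (\<delta> + \<delta>)"
    "bracket (cone_sigma c X) (cone_sigma c X) (cone_tau c X) = ident (cE c X)"
  using assms
  by (simp_all add: cone_sigma_def cone_tau_def closed_arr_def arr_def cone_data_simps sign_def
    bracket_def parity_deg1)

lemma cone_map_arr:
  assumes "cone_data c X" "cone_data c Y" "arr f X Y n"
  shows "arr (cone_map c X Y f) (cE c X) (cE c Y) n"
  using assms(3) by (simp_all add: cone_map_def arr_def cone_data_simps assms(1,2) add.commute)

text \<open>
  The terms containing \<open>d f\<close> and those containing \<open>f\<close> cancel separately; the third summand of the
  functor is what makes this happen for morphisms \<open>f\<close> that are not closed.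
\<close>

lemma cone_map_closed:
  assumes "cone_data c X" "cone_data c Y" "arr f X Y n"
  shows "D (cone_map c X Y f) = zero (cE c X) (cE c Y) (n + \<delta>)"
  using assms(3)
  by (cases rule: parity_cases[of \<delta> n])
   (simp_all add: cone_map_def arr_def cone_data_simps assms(1,2) degree_simps)

text \<open>
  Both \<open>\<sigma> F(f)\<close> and \<open>(-1)^n F(f) \<sigma>\<close> are \<open>\<iota>' f \<pi>'\<close>.
\<close>

lemma cone_map_sigma:
  assumes "cone_data c X" "cone_data c Y" "arr f X Y n"
  shows "bracket (cone_sigma c Y) (cone_sigma c X) (cone_map c X Y f) = zero (cE c X) (cE c Y) (- \<delta> + n)"
  using assms(3)
  by (cases rule: parity_cases[of \<delta> n])
   (simp_all add: cone_map_def arr_def bracket_def cone_sigma_def cone_data_simps assms(1,2) degree_simps)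

text \<open>
  Here \<open>\<tau> F(f) = (-1)^n \<iota> f \<pi> + \<iota> (d f) \<pi>'\<close> and \<open>F(f) \<tau> = \<iota> f \<pi> + \<iota>' (d f) \<pi>\<close>, so the terms with \<open>f\<close>
  cancel in the bracket. Thus the functor intertwines \<open>d\<close> with the differential of \<open>A\<^sup>\<natural>\<^sup>\<natural>\<close>.
\<close>

lemma cone_map_tau:
  assumes "cone_data c X" "cone_data c Y" "arr f X Y n"
  shows "bracket (cone_tau c Y) (cone_tau c X) (cone_map c X Y f) = cone_map c X Y (D f)"
  using assms(3)
  by (cases rule: parity_cases[of \<delta> n])
   (simp_all add: cone_map_def arr_def bracket_def cone_tau_def cone_data_simps assms(1,2) degree_simps)

lemma cone_map_ident: "cone_data c X \<Longrightarrow> cone_map c X X (ident X) = ident (cE c X)"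
  by (simp add: cone_map_def cone_data_simps sign_def)

lemma cone_map_plus:
  assumes "cone_data c X" "cone_data c Y" "arr f X Y n" "arr g X Y n"
  shows "cone_map c X Y (f \<boxplus> g) = cone_map c X Y f \<boxplus> cone_map c X Y g"
  using assms(3,4)
  by (cases rule: parity_cases[of \<delta> n])
   (simp_all add: cone_map_def arr_def cone_data_simps assms(1,2) degree_simps)

lemma cone_map_comp:
  assumes "cone_data c X" "cone_data c Y" "cone_data c Z" "arr f X Y i" "arr g Y Z j"
  shows "cone_map c X Z (g \<bullet> f) = cone_map c Y Z g \<bullet> cone_map c X Y f"
  using assms(4,5)
  by (cases rule: parity_cases[of \<delta> i]; cases rule: parity_cases[of \<delta> j])
   (simp_all add: cone_map_def arr_def cone_data_simps assms(1-3) degree_simps)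

lemma cone_map_inverse:
  assumes "cone_data c X" "cone_data c Y" "arr f X Y n"
  shows "prj' c Y \<bullet> cone_map c X Y f \<bullet> inc c X = f"
  using assms(3)
  by (cases rule: parity_cases[of \<delta> n])
   (simp_all add: cone_map_def arr_def cone_data_simps assms(1,2) degree_simps)

lemma arr_val: "arr f X Y n \<Longrightarrow> val f \<in> mor A X Y n"
  by (auto simp: arr_def valid_def simp del: valid_src valid_tgt)

lemma plus_neg_eq_zeroD:
  assumes "f \<boxplus> \<boxminus> g = zero X Y n" "arr f X Y n" "arr g X Y n"
  shows "f = g"
  using neg_unique[of f "\<boxminus> g"] assms by (simp add: arr_def)

lemma plus_eq_zeroD:
  assumes "f \<boxplus> g = zero X Y n" "arr f X Y n" "arr g X Y n"
  shows "f = \<boxminus> g"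
  using neg_unique[of f g] assms by (simp add: arr_def)

text \<open>
  Commutation with \<open>\<sigma>\<close> determines \<open>h\<close> on the image of \<open>\<iota>'\<close>, and its derivative determines \<open>h\<close> on the
  image of \<open>\<iota> = d \<iota>'\<close>.
\<close>

lemma cone_map_full:
  assumes X: "cone_data c X" and Y: "cone_data c Y" and h: "closed_arr h (cE c X) (cE c Y) n"
    and contr: "bracket (cone_sigma c Y) (cone_sigma c X) h = zero (cE c X) (cE c Y) (- \<delta> + n)"
  shows "cone_map c X Y (prj' c Y \<bullet> h \<bullet> inc c X) = h"
proof -
  note [simp] = cone_data_simps[OF X] cone_data_simps[OF Y] h[unfolded closed_arr_def arr_def]
  define f where "f = prj' c Y \<bullet> h \<bullet> inc c X"
  have f [simp]: "valid f" "src f = X" "tgt f = Y" "deg f = n"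
    by (simp_all add: f_def)
  have "cone_sigma c Y \<bullet> h = sign n (h \<bullet> cone_sigma c X)"
    by (rule plus_neg_eq_zeroD[OF contr[unfolded bracket_def, simplified]])
       (simp_all add: cone_sigma_def arr_def)
  then have "(cone_sigma c Y \<bullet> h) \<bullet> inc c X = sign n (h \<bullet> cone_sigma c X) \<bullet> inc c X"
    by (rule arg_cong)
  \<comment> \<open>composing with \<open>\<iota>\<close> cancels the factor \<open>\<pi>'\<close> of \<open>\<sigma>\<close> on the right\<close>
  then have 1: "h \<bullet> inc' c X = sign n (inc' c Y \<bullet> f)"
    by (cases rule: parity_cases[of \<delta> n]) (simp_all add: cone_sigma_def f_def sign_def)
  then have "sign n (h \<bullet> inc' c X) = inc' c Y \<bullet> f"
    by (cases rule: parity_cases[of \<delta> n]) (simp_all add: sign_def)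
  then have "D (sign n (h \<bullet> inc' c X)) = D (inc' c Y \<bullet> f)"
    by (rule arg_cong)
  then have 2: "h \<bullet> inc c X = inc c Y \<bullet> f \<boxplus> inc' c Y \<bullet> D f"
    by (cases rule: parity_cases[of \<delta> n]) (simp_all add: sign_def)
  have "h = h \<bullet> (inc c X \<bullet> prj' c X \<boxplus> inc' c X \<bullet> prj c X)"
    by simp
  also have "\<dots> = (h \<bullet> inc c X) \<bullet> prj' c X \<boxplus> (h \<bullet> inc' c X) \<bullet> prj c X"
    by (subst comp_plus_right) simp_all
  also have "\<dots> = cone_map c X Y f"
    unfolding 1 2 cone_map_def by (cases rule: parity_cases[of \<delta> n]) (simp_all add: degree_simps)
  finally show ?thesis by (simp add: f_def)
qed

section \<open>The functor is fully faithful\<close>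

lemma natnat_obj_arrows:
  "fst (fst (natnat_obj A c X)) = cE c X"
  "sigma_arr (fst (natnat_obj A c X)) = cone_sigma c X"
  "tau_arr (natnat_obj A c X) = cone_tau c X"
  by (simp_all add: natnat_obj_def sigma_arr_def tau_arr_def cone_sigma_def cone_tau_def
    comp_def inc_def prj_def inc'_def prj'_def)

lemma natnat_obj_Obj: "cone_data c X \<Longrightarrow> natnat_obj A c X \<in> Obj (nat_dg \<Gamma> (nat_dg \<Gamma> A))"
  using cone_sigma_facts[of c X] cone_tau_facts[of c X]
  by (simp add: natnat_Obj_iff nat_dg_Obj_iff natnat_obj_arrows)

lemma natnat_mor_arrow:
  "Arrow (cE c X) (cE c Y) n (natnat_mor \<Gamma> A c X Y n f) = cone_map c X Y (Arrow X Y n f)"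
  by (rule arrow_eqI)
    (simp_all add: natnat_mor_def cone_map_def val_simps inc_def prj_def inc'_def prj'_def)

lemma natnat_mor_iff:
  assumes "cone_data c X" "cone_data c Y"
  shows "h \<in> mor (nat_dg \<Gamma> (nat_dg \<Gamma> A)) (natnat_obj A c X) (natnat_obj A c Y) n \<longleftrightarrow>
    closed_arr (Arrow (cE c X) (cE c Y) n h) (cE c X) (cE c Y) n \<and>
    bracket (cone_sigma c Y) (cone_sigma c X) (Arrow (cE c X) (cE c Y) n h) =
      zero (cE c X) (cE c Y) (- \<delta> + n)"
  using assms natnat_obj_Obj[of c X] natnat_obj_Obj[of c Y]
  by (simp add: closed_nat_dg_iff natnat_obj_arrows natnat_Obj_iff)

lemma natnat_mor_mor:
  assumes "cone_data c X" "cone_data c Y" "f \<in> mor A X Y n"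
  shows "natnat_mor \<Gamma> A c X Y n f \<in>
    mor (nat_dg \<Gamma> (nat_dg \<Gamma> A)) (natnat_obj A c X) (natnat_obj A c Y) n"
  using assms cone_map_arr[of c X Y] cone_map_closed[of c X Y] cone_map_sigma[of c X Y]
  by (simp only: natnat_mor_iff natnat_mor_arrow closed_arr_def arr_Arrow cone_dataD)

lemma natnat_chain_map:
  assumes X: "cone_data c X" and Y: "cone_data c Y"
  shows "chain_map \<Gamma> (Hom A X Y)
    (Hom (nat_dg \<Gamma> (nat_dg \<Gamma> A)) (natnat_obj A c X) (natnat_obj A c Y)) (natnat_mor \<Gamma> A c X Y)"
  (is "chain_map \<Gamma> _ (Hom ?NN ?FX ?FY) ?F")
proof -
  note Obj = cone_dataD(1)[OF X] cone_dataD(1)[OF Y]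
  have plus: "?F n (f \<oplus>\<^bsub>HomG A X Y n\<^esub> g) = ?F n f \<oplus>\<^bsub>HomG A (cE c X) (cE c Y) n\<^esub> ?F n g"
    if "f \<in> mor A X Y n" "g \<in> mor A X Y n" for n f g
  proof -
    have "cone_map c X Y (Arrow X Y n f \<boxplus> Arrow X Y n g) =
        cone_map c X Y (Arrow X Y n f) \<boxplus> cone_map c X Y (Arrow X Y n g)"
      using that Obj by (intro cone_map_plus[OF X Y arr_Arrow arr_Arrow])
    then show ?thesis by (simp add: plus_def flip: natnat_mor_arrow)
  qed
  have dif: "Dif ?NN ?FX ?FY n (?F n f) = ?F (n + \<delta>) (Dif A X Y n f)"
    if f: "f \<in> mor A X Y n" for n f
  proof -
    have "bracket (cone_tau c Y) (cone_tau c X) (cone_map c X Y (Arrow X Y n f)) =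
        cone_map c X Y (D (Arrow X Y n f))"
      using f Obj by (intro cone_map_tau[OF X Y arr_Arrow])
    then show ?thesis
      using natnat_Dif[OF natnat_obj_Obj[OF X] natnat_obj_Obj[OF Y] natnat_mor_mor[OF X Y f]]
      by (simp add: D_def natnat_obj_arrows flip: natnat_mor_arrow)
  qed
  show ?thesis
    unfolding chain_map_def
    using natnat_mor_mor[OF X Y] plus dif by (auto simp: hom_def natnat_obj_arrows simp del: natnat_simps(3))
qed

lemma natnat_functor:
  assumes c: "\<And>X. X \<in> Obj A \<Longrightarrow> cone_data c X"
  shows "dg_functor \<Gamma> A (nat_dg \<Gamma> (nat_dg \<Gamma> A)) (natnat_obj A c) (natnat_mor \<Gamma> A c)"
proof (intro dg_functor.intro dg_functor_axioms.intro dg_category_axioms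
    dg_category.nat_dg_category[OF nat_dg_category])
  fix X assume "X \<in> Obj A"
  then show "natnat_obj A c X \<in> Obj (nat_dg \<Gamma> (nat_dg \<Gamma> A))"
    by (intro natnat_obj_Obj c)
  have "cone_map c X X (ident X) = ident (cE c X)"
    using \<open>X \<in> Obj A\<close> by (intro cone_map_ident c)
  then show "natnat_mor \<Gamma> A c X X 0 (Idm A X) = Idm (nat_dg \<Gamma> (nat_dg \<Gamma> A)) (natnat_obj A c X)"
    by (simp add: ident_def natnat_obj_arrows flip: natnat_mor_arrow)
next
  fix X Y assume "X \<in> Obj A" "Y \<in> Obj A"
  then show "chain_map \<Gamma> (Hom A X Y)
      (Hom (nat_dg \<Gamma> (nat_dg \<Gamma> A)) (natnat_obj A c X) (natnat_obj A c Y)) (natnat_mor \<Gamma> A c X Y)"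
    by (intro natnat_chain_map c)
next
  fix X Y Z f i g j
  assume *: "X \<in> Obj A" "Y \<in> Obj A" "Z \<in> Obj A" "f \<in> mor A X Y i" "g \<in> mor A Y Z j"
  then have "cone_map c X Z (Arrow Y Z j g \<bullet> Arrow X Y i f) =
      cone_map c Y Z (Arrow Y Z j g) \<bullet> cone_map c X Y (Arrow X Y i f)"
    by (intro cone_map_comp[OF _ _ _ arr_Arrow arr_Arrow] c)
  then show "natnat_mor \<Gamma> A c X Z (j + i) (Cmp A g f) =
      Cmp (nat_dg \<Gamma> (nat_dg \<Gamma> A)) (natnat_mor \<Gamma> A c Y Z j g) (natnat_mor \<Gamma> A c X Y i f)"
    by (simp add: comp_def flip: natnat_mor_arrow)
qed

lemma natnat_fully_faithful:
  assumes c: "\<And>X. X \<in> Obj A \<Longrightarrow> cone_data c X"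
  shows "fully_faithful \<Gamma> A (nat_dg \<Gamma> (nat_dg \<Gamma> A)) (natnat_obj A c) (natnat_mor \<Gamma> A c)"
  unfolding fully_faithful_def complex_iso_def
proof (intro ballI conjI allI)
  fix X Y :: 'o and n :: 'g assume "X \<in> Obj A" "Y \<in> Obj A"
  then have X: "cone_data c X" and Y: "cone_data c Y" by (auto intro: c)
  then show "chain_map \<Gamma> (Hom A X Y)
      (Hom (nat_dg \<Gamma> (nat_dg \<Gamma> A)) (natnat_obj A c X) (natnat_obj A c Y)) (natnat_mor \<Gamma> A c X Y)"
    by (rule natnat_chain_map)
  let ?h = "\<lambda>h. Arrow (cE c X) (cE c Y) n h"
  let ?inv = "\<lambda>h. prj' c Y \<bullet> ?h h \<bullet> inc c X"
  show "bij_betw (natnat_mor \<Gamma> A c X Y n) (mor A X Y n)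
      (mor (nat_dg \<Gamma> (nat_dg \<Gamma> A)) (natnat_obj A c X) (natnat_obj A c Y) n)"
  proof (rule bij_betw_byWitness[where f' = "\<lambda>h. val (?inv h)"])
    show "\<forall>f\<in>mor A X Y n. val (?inv (natnat_mor \<Gamma> A c X Y n f)) = f"
      using cone_map_inverse[OF X Y] arr_Arrow cone_dataD(1)[OF X] cone_dataD(1)[OF Y]
      unfolding natnat_mor_arrow by fastforce
    have inv: "arr (?inv h) X Y n \<and> cone_map c X Y (?inv h) = ?h h"
      if "h \<in> mor (nat_dg \<Gamma> (nat_dg \<Gamma> A)) (natnat_obj A c X) (natnat_obj A c Y) n" for h
    proof
      show "cone_map c X Y (?inv h) = ?h h"
        using that cone_map_full[OF X Y] unfolding natnat_mor_iff[OF X Y] by blast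
      show "arr (?inv h) X Y n"
        using that unfolding natnat_mor_iff[OF X Y]
        by (simp add: closed_arr_def arr_def cone_dataD[OF X] cone_dataD[OF Y])
    qed
    have inv_arrow: "Arrow X Y n (val (?inv h)) = ?inv h" if "arr (?inv h) X Y n" for h
      using that by (intro arrow_eqI) (simp_all add: arr_def)
    show "\<forall>h\<in>mor (nat_dg \<Gamma> (nat_dg \<Gamma> A)) (natnat_obj A c X) (natnat_obj A c Y) n.
        natnat_mor \<Gamma> A c X Y n (val (?inv h)) = h"
      using inv inv_arrow natnat_mor_arrow[of c X Y n] by (metis arrow.inject)
    show "natnat_mor \<Gamma> A c X Y n ` mor A X Y n \<subseteq>
        mor (nat_dg \<Gamma> (nat_dg \<Gamma> A)) (natnat_obj A c X) (natnat_obj A c Y) n"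
      using natnat_mor_mor[OF X Y] by auto
    show "(\<lambda>h. val (?inv h)) ` mor (nat_dg \<Gamma> (nat_dg \<Gamma> A)) (natnat_obj A c X) (natnat_obj A c Y) n
        \<subseteq> mor A X Y n"
      using inv by (auto intro!: arr_val simp del: natnat_simps(3))
  qed
qed

section \<open>Cones of identity morphisms exist\<close>

text \<open>
  The cone of \<open>id_S\<close> represents the functor taking \<open>Z\<close> to the cone of the identity of \<open>Hom(Z, S)\<close>. As
  in the Yoneda lemma, the isomorphism is composition with the pair \<open>(q', q)\<close> that corresponds to the
  identity of \<open>E\<close>, so morphisms into \<open>E\<close> are determined by, and can be prescribed by, their composites
  with \<open>q'\<close> and \<open>q\<close>. Closedness of the identity gives \<open>D q' = - q\<close>, and \<open>D j = j'\<close> holds because both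
  sides have the same composites with \<open>q'\<close> and \<open>q\<close>.
\<close>

lemma is_cone_ident_arrows:
  assumes S: "S \<in> Obj A" and cone: "is_cone \<Gamma> A S S (Idm A S) E"
  obtains q q' j j' where
    "arr q E S \<delta>" "arr q' E S 0" "arr j S E (- \<delta>)" "arr j' S E 0"
    "q' \<bullet> j' = ident S" "q \<bullet> j' = zero S S \<delta>" "q' \<bullet> j = zero S S (- \<delta>)" "q \<bullet> j = ident S"
    "j' \<bullet> q' \<boxplus> j \<bullet> q = ident E" "D q' = \<boxminus> q" "D j = j'"
proof -
  from cone obtain \<Phi> where E: "E \<in> Obj A"
    and iso: "\<And>Z. Z \<in> Obj A \<Longrightarrow> complex_iso \<Gamma> (Hom A Z E)
      (cone_cpx \<Gamma> (Hom A Z S) (Hom A Z S) (\<lambda>n. Cmp A (Idm A S))) (\<Phi> Z)"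
    and nat: "\<And>Z Z' n j g h. \<lbrakk>Z \<in> Obj A; Z' \<in> Obj A; g \<in> mor A Z E n; h \<in> mor A Z' Z j\<rbrakk> \<Longrightarrow>
      \<Phi> Z' (n + j) (Cmp A g h) = (Cmp A (fst (\<Phi> Z n g)) h, Cmp A (snd (\<Phi> Z n g)) h)"
    unfolding is_cone_def by blast
  note [simp] = S E
  define q' :: "('g, 'o, 'm) arrow" where "q' = Arrow E S 0 (fst (\<Phi> E 0 (Idm A E)))"
  define q :: "('g, 'o, 'm) arrow" where "q = Arrow E S \<delta> (snd (\<Phi> E 0 (Idm A E)))"
  have bij: "bij_betw (\<Phi> Z n) (mor A Z E n) (mor A Z S n \<times> mor A Z S (n + \<delta>))" if "Z \<in> Obj A" for Z n
    using iso[OF that] by (simp add: complex_iso_def cone_cpx_def RDirProd_carrier)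
  have \<Phi>: "\<Phi> Z n g = (val (q' \<bullet> Arrow Z E n g), val (q \<bullet> Arrow Z E n g))"
    if "Z \<in> Obj A" "g \<in> mor A Z E n" for Z n g
    using nat[of E Z "Idm A E" 0 g n] Cmp_Idm_left[of Z E g n] that
    by (simp add: Idm_mor q_def q'_def val_simps)
  have "\<Phi> E 0 (Idm A E) \<in> mor A E S 0 \<times> mor A E S (0 + \<delta>)"
    using bij_betw_apply[OF bij Idm_mor] by simp
  then have q: "arr q E S \<delta>" "arr q' E S 0"
    unfolding q_def q'_def by (auto intro!: arr_Arrow)
  note [simp] = q[unfolded arr_def]
  \<comment> \<open>the cone property of \<open>E\<close>: uniqueness and existence of morphisms with given components\<close>
  have eqI: "g = h" if "arr g Z E n" "arr h Z E n" "q' \<bullet> g = q' \<bullet> h" "q \<bullet> g = q \<bullet> h" for g h Z n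
  proof -
    have "\<Phi> Z n (val g) = \<Phi> Z n (val h)"
      using that arr_val[OF that(1)] arr_val[OF that(2)]
      by (cases g; cases h) (simp add: \<Phi> arr_def)
    then have "val g = val h"
      using that arr_val[OF that(1)] arr_val[OF that(2)] bij[of Z n]
      by (auto simp: arr_def bij_betw_def dest: inj_onD)
    then show ?thesis using that by (auto simp: arr_def intro: arrow_eqI)
  qed
  have ex: "\<exists>g. arr g Z E n \<and> q' \<bullet> g = y \<and> q \<bullet> g = x"
    if "arr y Z S n" "arr x Z S (n + \<delta>)" for x y Z n
  proof -
    have "(val y, val x) \<in> \<Phi> Z n ` mor A Z E n"
      using that arr_val[OF that(1)] arr_val[OF that(2)] bij[of Z n]
      by (auto simp: arr_def bij_betw_def)
    then obtain g where g: "g \<in> mor A Z E n" "\<Phi> Z n g = (val y, val x)" by force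
    have "arr (Arrow Z E n g) Z E n"
      using that g by (intro arr_Arrow) (auto simp: arr_def)
    moreover have "q' \<bullet> Arrow Z E n g = y" "q \<bullet> Arrow Z E n g = x"
      using that g by (auto simp: arr_def \<Phi> add.commute intro!: arrow_eqI)
    ultimately show ?thesis by blast
  qed
  have "dif (cone_cpx \<Gamma> (Hom A E S) (Hom A E S) (\<lambda>n. Cmp A (Idm A S))) 0 (\<Phi> E 0 (Idm A E)) =
      \<Phi> E \<delta> (Dif A E E 0 (Idm A E))"
    using iso[of E] Idm_mor[of E] unfolding complex_iso_def chain_map_def by auto
  also have "\<dots> = (val (zero E S \<delta>), val (zero E S (\<delta> + \<delta>)))"
    using \<Phi>[of E "\<zero>\<^bsub>HomG A E E \<delta>\<^esub>" \<delta>] arr_val[of "zero E E \<delta>" E E \<delta>] Idm_closed[of E]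
    by (simp add: zero_def[symmetric] arr_def val_simps(4))
  finally have d: "D q' \<boxplus> q = zero E S \<delta>" "\<boxminus> (D q) = zero E S (\<delta> + \<delta>)"
    using Cmp_Idm_left[OF E S arr_val[OF q(1)]]
    by (auto simp: cone_cpx_def D_def plus_def neg_def zero_def q_def q'_def split_beta)
  have dq': "D q' = \<boxminus> q"
    using d(1) by (rule plus_eq_zeroD) (simp_all add: arr_def)
  have dq [simp]: "D q = zero E S (\<delta> + \<delta>)"
    using arg_cong[OF d(2), of neg] by simp
  obtain j' where j': "arr j' S E 0" and [simp]: "q' \<bullet> j' = ident S" "q \<bullet> j' = zero S S \<delta>"
    using ex[of "ident S" S 0 "zero S S \<delta>"] by (auto simp: arr_def)
  obtain j where j: "arr j S E (- \<delta>)" and [simp]: "q' \<bullet> j = zero S S (- \<delta>)" "q \<bullet> j = ident S"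
    using ex[of "zero S S (- \<delta>)" S "- \<delta>" "ident S"] by (auto simp: arr_def)
  note [simp] = j[unfolded arr_def] j'[unfolded arr_def]
  have "D j = j'"
  proof (rule eqI)
    \<comment> \<open>the derivatives of \<open>q' j = 0\<close> and \<open>q j = id\<close>\<close>
    have "\<boxminus> (ident S) \<boxplus> q' \<bullet> D j = zero S S 0"
      using D_comp[of j q'] by (simp add: dq' sign_def)
    from arg_cong[OF this, of "plus (ident S)"] show "q' \<bullet> D j = q' \<bullet> j'" by simp
    have "\<boxminus> (q \<bullet> D j) = zero S S \<delta>"
      using D_comp[of j q] by (simp add: sign_def parity_deg1)
    from arg_cong[OF this, of neg] show "q \<bullet> D j = q \<bullet> j'" by simp
  qed (auto simp: arr_def)
  moreover have "j' \<bullet> q' \<boxplus> j \<bullet> q = ident E"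
    by (rule eqI[of _ E 0]) (simp_all add: arr_def comp_reassoc[of _ _ _ q] comp_reassoc[of _ _ _ q'])
  ultimately show thesis
    using that[of q q' j j'] q dq' j j' by simp
qed
text \<open>
  A family that is constant in the object, so that morphisms given for a single object can take the
  place of a choice of cones.
\<close>

definition const_cone_choice ::
  "'o \<Rightarrow> ('g, 'o, 'm) arrow \<Rightarrow> ('g, 'o, 'm) arrow \<Rightarrow> ('g, 'o, 'm) arrow \<Rightarrow> ('g, 'o, 'm) arrow
    \<Rightarrow> ('o, 'm) cone_choice" where
  "const_cone_choice E i p i' p' =
    \<lparr>cE = \<lambda>_. E, c\<iota> = \<lambda>_. val i, c\<pi> = \<lambda>_. val p, c\<iota>' = \<lambda>_. val i', c\<pi>' = \<lambda>_. val p'\<rparr>"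

lemma const_cone_choice_cE [simp]: "cE (const_cone_choice E i p i' p') X = E"
  by (simp add: const_cone_choice_def)

lemma const_cone_choice_arrows:
  assumes "arr i X E \<delta>" "arr p E X 0" "arr i' X E 0" "arr p' E X (- \<delta>)"
  shows "inc (const_cone_choice E i p i' p') X = i" "prj (const_cone_choice E i p i' p') X = p"
    "inc' (const_cone_choice E i p i' p') X = i'" "prj' (const_cone_choice E i p i' p') X = p'"
  using assms by (auto simp: const_cone_choice_def inc_def prj_def inc'_def prj'_def arr_def intro!: arrow_eqI)

text \<open>
  The morphisms for the cone of \<open>id_S\<close> with \<open>S = X[-1]\<close> are transported to \<open>X\<close> along the closed
  isomorphisms \<open>u : X \<rightarrow> S\<close> and \<open>v : S \<rightarrow> X\<close> of degrees \<open>1\<close> and \<open>-1\<close>.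
\<close>

lemma cone_data_of_shift_cone:
  assumes X: "X \<in> Obj A" and S: "is_shift \<Gamma> A X (- \<delta>) S" and E: "is_cone \<Gamma> A S S (Idm A S) E"
  shows "\<exists>c. cE c X = E \<and> cone_data c X"
proof -
  from S have S': "S \<in> Obj A" by (simp add: is_shift_def)
  from S X S' obtain u0 v0 where uv0: "u0 \<in> closed_mor \<Gamma> A X S \<delta>" "v0 \<in> closed_mor \<Gamma> A S X (- \<delta>)"
    "Cmp A v0 u0 = Idm A X" "Cmp A u0 v0 = Idm A S"
    unfolding is_shift_def by auto
  define u where "u = Arrow X S \<delta> u0"
  define v where "v = Arrow S X (- \<delta>) v0"
  have uv: "closed_arr u X S \<delta>" "closed_arr v S X (- \<delta>)" "v \<bullet> u = ident X" "u \<bullet> v = ident S"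
    using uv0 X S' by (simp_all add: u_def v_def closed_mor_iff_arr comp_def ident_def)
  from is_cone_ident_arrows[OF S' E] obtain q q' j j' where q: "arr q E S \<delta>" "arr q' E S 0" "arr j S E (- \<delta>)" "arr j' S E 0"
    "q' \<bullet> j' = ident S" "q \<bullet> j' = zero S S \<delta>" "q' \<bullet> j = zero S S (- \<delta>)" "q \<bullet> j = ident S"
    "j' \<bullet> q' \<boxplus> j \<bullet> q = ident E" "D q' = \<boxminus> q" "D j = j'" .
  note [simp] = X S' uv[unfolded closed_arr_def arr_def] q[unfolded arr_def]
  have [simp]: "D j' = zero S E \<delta>" "D q = zero E S (\<delta> + \<delta>)"
    using D_D[of j] arg_cong[OF D_D[of q'], of neg] by simp_all
  note reassoc = comp_reassoc[OF q(5)] comp_reassoc[OF q(6)] comp_reassoc[OF q(7)] comp_reassoc[OF q(8)]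
    comp_reassoc[OF uv(3)] comp_reassoc[OF uv(4)]
  let ?c = "const_cone_choice E (j' \<bullet> u) (v \<bullet> q) (j \<bullet> u) (v \<bullet> q')"
  have "arr (j' \<bullet> u) X E \<delta>" "arr (v \<bullet> q) E X 0" "arr (j \<bullet> u) X E 0" "arr (v \<bullet> q') E X (- \<delta>)"
    by (simp_all add: arr_def)
  note arrows = const_cone_choice_arrows[OF this]
  have "cone_data ?c X"
    unfolding cone_data_def arrows
    by (simp add: closed_arr_def arr_def reassoc sign_def parity_deg1)
  then show ?thesis by (intro exI[of _ ?c]) simp
qed

lemma cone_choice_ok_iff:
  "cone_choice_ok \<Gamma> A c \<longleftrightarrow> (\<forall>X \<in> Obj A.
    (\<exists>S. is_shift \<Gamma> A X (- \<delta>) S \<and> is_cone \<Gamma> A S S (Idm A S) (cE c X)) \<and> cone_data c X)"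
proof -
  have *: "cE c X \<in> Obj A" if "\<exists>S. is_shift \<Gamma> A X (- \<delta>) S \<and> is_cone \<Gamma> A S S (Idm A S) (cE c X)" for X
    using that by (auto simp: is_cone_def)
  show ?thesis
    unfolding cone_choice_ok_def Let_def
    by (intro ball_cong refl conj_cong) (simp add: cone_data_iff * Let_def)
qed

lemma ex_cone_choice:
  assumes "has_shifts \<Gamma> A" "has_cones \<Gamma> A"
  shows "\<exists>c. cone_choice_ok \<Gamma> A c"
proof -
  have "\<exists>c. (\<exists>S. is_shift \<Gamma> A X (- \<delta>) S \<and> is_cone \<Gamma> A S S (Idm A S) (cE c X)) \<and> cone_data c X"
    if X: "X \<in> Obj A" for X
  proof -
    from assms(1) X obtain S where S: "is_shift \<Gamma> A X (- \<delta>) S" by (auto simp: has_shifts_def)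
    then have "S \<in> Obj A" by (simp add: is_shift_def)
    then have "Idm A S \<in> closed_mor \<Gamma> A S S 0"
      using closed_mor_val[OF closed_arr_ident] by (simp add: val_simps)
    then obtain E where "is_cone \<Gamma> A S S (Idm A S) E"
      using assms(2) \<open>S \<in> Obj A\<close> unfolding has_cones_def by blast
    then show ?thesis using cone_data_of_shift_cone[OF X S] S by metis
  qed
  then obtain d where d: "\<And>X. X \<in> Obj A \<Longrightarrow>
      (\<exists>S. is_shift \<Gamma> A X (- \<delta>) S \<and> is_cone \<Gamma> A S S (Idm A S) (cE (d X) X)) \<and> cone_data (d X) X"
    by metis
  define c where "c = \<lparr>cE = \<lambda>X. cE (d X) X, c\<iota> = \<lambda>X. c\<iota> (d X) X, c\<pi> = \<lambda>X. c\<pi> (d X) X,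
    c\<iota>' = \<lambda>X. c\<iota>' (d X) X, c\<pi>' = \<lambda>X. c\<pi>' (d X) X\<rparr>"
  have "cE c X = cE (d X) X" "cone_data c X = cone_data (d X) X" for X
    by (simp_all add: c_def cone_data_def inc_def prj_def inc'_def prj'_def)
  then have "cone_choice_ok \<Gamma> A c" using d by (simp add: cone_choice_ok_iff)
  then show ?thesis ..
qed

section \<open>Essential surjectivity\<close>

text \<open>
  The morphism between two cones of \<open>id_X[-1]\<close> that takes \<open>\<iota>\<close> to \<open>\<iota>\<close> and \<open>\<iota>'\<close> to \<open>\<iota>'\<close>.
\<close>

definition cone_transfer ::
  "('o, 'm) cone_choice \<Rightarrow> ('o, 'm) cone_choice \<Rightarrow> 'o \<Rightarrow> ('g, 'o, 'm) arrow" where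
  "cone_transfer c c' X = inc c' X \<bullet> prj' c X \<boxplus> inc' c' X \<bullet> prj c X"

lemma cone_transfer_inverse:
  assumes "cone_data c X" "cone_data c' X"
  shows "cone_transfer c' c X \<bullet> cone_transfer c c' X = ident (cE c X)"
  by (simp add: cone_transfer_def cone_data_simps[OF assms(1)] cone_data_simps[OF assms(2)])

lemma cone_transfer_closed:
  assumes "cone_data c X" "cone_data c' X"
  shows "closed_arr (cone_transfer c c' X) (cE c X) (cE c' X) 0"
  by (simp add: cone_transfer_def closed_arr_def arr_def cone_data_simps[OF assms(1)]
    cone_data_simps[OF assms(2)] degree_simps)

lemma cone_transfer_brackets:
  assumes "cone_data c X" "cone_data c' X"
  shows "bracket (cone_sigma c' X) (cone_sigma c X) (cone_transfer c c' X) =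
      zero (cE c X) (cE c' X) (- \<delta>)"
    "bracket (cone_tau c' X) (cone_tau c X) (cone_transfer c c' X) =
      zero (cE c X) (cE c' X) \<delta>"
  by (simp_all add: cone_transfer_def bracket_def cone_sigma_def cone_tau_def
    cone_data_simps[OF assms(1)] cone_data_simps[OF assms(2)] sign_def)

lemma cone_transfer_natnat:
  assumes c: "cone_data c X" and c': "cone_data c' X"
  shows "val (cone_transfer c c' X) \<in>
    closed_mor \<Gamma> (nat_dg \<Gamma> (nat_dg \<Gamma> A)) (natnat_obj A c X) (natnat_obj A c' X) 0"
proof -
  let ?P = "natnat_obj A c X" and ?Q = "natnat_obj A c' X" and ?f = "cone_transfer c c' X"
  have P: "?P \<in> Obj (nat_dg \<Gamma> (nat_dg \<Gamma> A))" and Q: "?Q \<in> Obj (nat_dg \<Gamma> (nat_dg \<Gamma> A))"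
    using c c' by (auto intro: natnat_obj_Obj)
  have eq: "Arrow (cE c X) (cE c' X) 0 (val ?f) = ?f"
    using cone_transfer_closed[OF c c'] by (intro arrow_eqI) (simp_all add: closed_arr_def arr_def)
  have "val ?f \<in> mor (nat_dg \<Gamma> (nat_dg \<Gamma> A)) ?P ?Q 0"
    using closed_nat_dg_iff[of "fst ?P" "fst ?Q" "val ?f" 0] P Q cone_transfer_closed[OF c c']
      cone_transfer_brackets(1)[OF c c']
    by (simp add: natnat_obj_arrows natnat_Obj_iff eq)
  moreover from natnat_Dif[OF P Q this]
  have "Dif (nat_dg \<Gamma> (nat_dg \<Gamma> A)) ?P ?Q 0 (val ?f) = val (zero (cE c X) (cE c' X) \<delta>)"
    by (simp add: natnat_obj_arrows eq cone_transfer_brackets(2)[OF c c'])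
  ultimately show ?thesis
    by (simp add: closed_mor_def[of \<Gamma> "nat_dg \<Gamma> (nat_dg \<Gamma> A)"] natnat_obj_arrows val_simps)
qed

lemma natnat_obj_isomorphic:
  assumes "cone_data c X" "cone_data c' X"
  shows "closed_isomorphic \<Gamma> (nat_dg \<Gamma> (nat_dg \<Gamma> A)) (natnat_obj A c X) (natnat_obj A c' X)"
proof -
  have "Cmp A (val (cone_transfer c' c X)) (val (cone_transfer c c' X)) = Idm A (cE c X)"
    "Cmp A (val (cone_transfer c c' X)) (val (cone_transfer c' c X)) = Idm A (cE c' X)"
    using cone_transfer_inverse[OF assms] cone_transfer_inverse[OF assms(2,1)] by (metis val_simps(1,5))+
  then show ?thesis
    using cone_transfer_natnat[OF assms] cone_transfer_natnat[OF assms(2,1)]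
    unfolding closed_isomorphic_def by (auto simp: natnat_obj_arrows)
qed

text \<open>
  The equation for \<open>D g\<close> follows by differentiating \<open>g f = id\<close> and composing with \<open>g\<close>.
\<close>

lemma twist_arrows:
  assumes W: "W \<in> Obj A" and twists: "has_twists \<Gamma> A"
    and t: "closed_arr t W W \<delta>" "t \<bullet> t = zero W W (\<delta> + \<delta>)"
  obtains Y f g where "arr f W Y 0" "arr g Y W 0" "g \<bullet> f = ident W" "f \<bullet> g = ident Y"
    "D f = \<boxminus> (f \<bullet> t)" "D g = t \<bullet> g"
proof -
  note [simp] = W t[unfolded closed_arr_def arr_def]
  have "D (\<boxminus> t) \<boxplus> \<boxminus> t \<bullet> \<boxminus> t = zero W W (\<delta> + \<delta>)"
    by simp
  moreover have "src t = W" "tgt t = W" "deg t = \<delta>"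
    by simp_all
  ultimately have "Dif A W W \<delta> (val (\<boxminus> t)) \<oplus>\<^bsub>HomG A W W (\<delta> + \<delta>)\<^esub>
      Cmp A (val (\<boxminus> t)) (val (\<boxminus> t)) = \<zero>\<^bsub>HomG A W W (\<delta> + \<delta>)\<^esub>"
    unfolding plus_def D_def comp_def zero_def by (simp only: arrow_proj arrow.sel arrow.inject)
  then have "maurer_cartan \<Gamma> A W (val (\<boxminus> t))"
    using arr_val[of "\<boxminus> t" W W \<delta>] by (simp only: maurer_cartan_def) (simp add: arr_def)
  then obtain Y where "is_twist A W (val (\<boxminus> t)) Y"
    using twists W unfolding has_twists_def by blast
  then obtain f0 g0 where Y [simp]: "Y \<in> Obj A" and fg0: "f0 \<in> mor A W Y 0" "g0 \<in> mor A Y W 0"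
    "Cmp A g0 f0 = Idm A W" "Cmp A f0 g0 = Idm A Y" "Dif A W Y 0 f0 = Cmp A f0 (val (\<boxminus> t))"
    by (auto simp: is_twist_def)
  define f :: "('g, 'o, 'm) arrow" where "f = Arrow W Y 0 f0"
  define g :: "('g, 'o, 'm) arrow" where "g = Arrow Y W 0 g0"
  have fg: "arr f W Y 0" "arr g Y W 0" "g \<bullet> f = ident W" "f \<bullet> g = ident Y" "D f = f \<bullet> \<boxminus> t"
    using fg0 by (auto simp: f_def g_def arr_Arrow comp_def ident_def D_def)
  note [simp] = fg(1-4)[unfolded arr_def] comp_reassoc[OF fg(3)] comp_reassoc[OF fg(4)]
  have Df: "D f = \<boxminus> (f \<bullet> t)" using fg(5) by simp
  have "D g \<bullet> f \<boxplus> \<boxminus> t = zero W W \<delta>"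
    using D_comp[of f g] by (simp add: Df sign_def)
  then have "D g \<bullet> f = t"
    by (rule plus_neg_eq_zeroD) (simp_all add: arr_def)
  then have "(D g \<bullet> f) \<bullet> g = t \<bullet> g" by (rule arg_cong)
  then have "D g = t \<bullet> g" by simp
  with fg Df show thesis using that by blast
qed

lemma split_idempotent_arrows:
  assumes "idempotents_split (Z0 \<Gamma> A)" "closed_arr e Y Y 0" "e \<bullet> e = e"
  obtains B r m where "closed_arr r Y B 0" "closed_arr m B Y 0" "m \<bullet> r = e" "r \<bullet> m = ident B"
proof -
  have Y: "Y \<in> Obj A" using assms(2) by (simp add: closed_arr_def arr_def)
  have "Cmp A (val e) (val e) = val e"
    using arg_cong[OF assms(3), of val] by (simp add: val_simps)
  then obtain B r0 m0 where B: "B \<in> Obj A" and rm: "r0 \<in> closed_mor \<Gamma> A Y B 0" "m0 \<in> closed_mor \<Gamma> A B Y 0"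
    "Cmp A m0 r0 = val e" "Cmp A r0 m0 = Idm A B"
    using assms(1) Y closed_mor_val[OF assms(2)]
    unfolding idempotents_split_def Z0_def by auto blast
  show thesis
  proof
    show "closed_arr (Arrow Y B 0 r0) Y B 0" "closed_arr (Arrow B Y 0 m0) B Y 0"
      using rm Y B by (simp_all add: closed_mor_iff_arr)
    show "Arrow B Y 0 m0 \<bullet> Arrow Y B 0 r0 = e"
      using rm assms(2) by (intro arrow_eqI) (simp_all add: val_simps closed_arr_def arr_def)
    show "Arrow Y B 0 r0 \<bullet> Arrow B Y 0 m0 = ident B"
      using rm by (simp add: comp_def ident_def)
  qed
qed

text \<open>
  The object \<open>B\<close> is the image of the idempotent \<open>\<sigma>\<tau>\<close>, which exists after the twist by \<open>-\<tau>\<close> has made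
  the idempotent closed.
\<close>

lemma natnat_object_is_cone:
  assumes split: "idempotents_split (Z0 \<Gamma> A)" and twists: "has_twists \<Gamma> A"
    and P: "P \<in> Obj (nat_dg \<Gamma> (nat_dg \<Gamma> A))"
  obtains B c where "cone_data c B" "natnat_obj A c B = P"
proof -
  define W where "W = fst (fst P)"
  define s where "s = sigma_arr (fst P)"
  define t where "t = tau_arr P"
  have s: "arr s W W (- \<delta>)" "D s = ident W" "s \<bullet> s = zero W W (- \<delta> + - \<delta>)"
    and t: "closed_arr t W W \<delta>" "t \<bullet> t = zero W W (\<delta> + \<delta>)" "bracket s s t = ident W"
    using P by (auto simp: natnat_Obj_iff nat_dg_Obj_iff W_def s_def t_def)
  have W [simp]: "W \<in> Obj A" using s by (simp add: arr_def)
  note [simp] = s[unfolded arr_def] t(1,2)[unfolded closed_arr_def arr_def]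
    comp_reassoc[OF s(3)] comp_reassoc[OF t(2)]
  have st: "s \<bullet> t \<boxplus> t \<bullet> s = ident W"
    using t(3) by (simp add: bracket_def sign_def parity_deg1)
  have "t \<bullet> (s \<bullet> t \<boxplus> t \<bullet> s) = t \<bullet> ident W" "s \<bullet> (s \<bullet> t \<boxplus> t \<bullet> s) = s \<bullet> ident W"
    unfolding st by simp_all
  then have tst: "t \<bullet> s \<bullet> t = t" and sts: "s \<bullet> t \<bullet> s = s" by simp_all
  have tst': "t \<bullet> s \<bullet> t \<bullet> x = t \<bullet> x" and sts': "s \<bullet> t \<bullet> s \<bullet> x = s \<bullet> x" if "valid x" "tgt x = W" for x
    using that arg_cong[OF tst, of "\<lambda>y. y \<bullet> x"] arg_cong[OF sts, of "\<lambda>y. y \<bullet> x"] by simp_all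
  note [simp] = tst sts tst' sts'
  obtain Y f g where fg: "arr f W Y 0" "arr g Y W 0" "g \<bullet> f = ident W" "f \<bullet> g = ident Y"
    "D f = \<boxminus> (f \<bullet> t)" "D g = t \<bullet> g"
    using twist_arrows[OF W twists t(1,2)] .
  note [simp] = fg[unfolded arr_def] comp_reassoc[OF fg(3)] comp_reassoc[OF fg(4)]
  \<comment> \<open>closed because \<open>D f\<close> contributes \<open>- f t s t g = - f t g\<close>, which cancels \<open>f (D s) t g\<close>,
        and \<open>D g = t g\<close> contributes a term with factor \<open>t t = 0\<close>\<close>
  define e where "e = f \<bullet> s \<bullet> t \<bullet> g"
  have e: "closed_arr e Y Y 0" "e \<bullet> e = e"
    by (simp_all add: e_def closed_arr_def arr_def sign_def parity_simps)
  obtain B r m where rm: "closed_arr r Y B 0" "closed_arr m B Y 0" "m \<bullet> r = e" "r \<bullet> m = ident B"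
    using split_idempotent_arrows[OF split e] .
  note [simp] = rm(1,2,4)[unfolded closed_arr_def arr_def] comp_reassoc[OF rm(4)]
  define p where "p = r \<bullet> f"
  define q where "q = g \<bullet> m"
  have [simp]: "valid p" "src p = W" "tgt p = B" "deg p = 0"
    "valid q" "src q = B" "tgt q = W" "deg q = 0" "D q = t \<bullet> q" "p \<bullet> q = ident B"
    by (simp_all add: p_def q_def sign_def)
  have qp: "q \<bullet> p = s \<bullet> t"
    using arg_cong[OF rm(3), of "\<lambda>x. g \<bullet> x \<bullet> f"] by (simp add: p_def q_def e_def)
  have "p \<bullet> q \<bullet> p = p" "(q \<bullet> p) \<bullet> q = q"
    by (simp_all add: comp_reassoc[of p q])
  then have pst: "p \<bullet> s \<bullet> t = p" and stq: "s \<bullet> t \<bullet> q = q"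
    by (simp_all add: qp del: comp_assoc) simp
  \<comment> \<open>closedness of \<open>p\<close> is special to the idempotent \<open>s t\<close>: \<open>D p = - p t\<close>, and \<open>p t = p s t t = 0\<close>\<close>
  have "p \<bullet> t = p \<bullet> s \<bullet> t \<bullet> t"
    using arg_cong[OF pst, of "\<lambda>x. x \<bullet> t"] by simp
  then have pt [simp]: "p \<bullet> t = zero W B \<delta>" by simp
  have Dp [simp]: "D p = zero W B \<delta>"
    using pt by (simp add: p_def sign_def)
  have sq [simp]: "s \<bullet> q = zero B W (- \<delta>)"
    using arg_cong[OF stq, of "\<lambda>x. s \<bullet> x"] by simp
  have ptx [simp]: "p \<bullet> t \<bullet> x = zero (src x) B (\<delta> + deg x)" if "valid x" "tgt x = W" for x
    using that comp_reassoc[OF pt, of x] by simp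
  define c where "c = const_cone_choice W (t \<bullet> q) p q (p \<bullet> s)"
  have "arr (t \<bullet> q) B W \<delta>" "arr p W B 0" "arr q B W 0" "arr (p \<bullet> s) W B (- \<delta>)"
    by (simp_all add: arr_def)
  note arrows = const_cone_choice_arrows[OF this, folded c_def]
  have cE: "cE c B = W" by (simp add: c_def)
  have qps: "q \<bullet> p \<bullet> s = s"
    using comp_reassoc[OF qp, of s] by simp
  have "cone_data c B"
    unfolding cone_data_def arrows cE
    using st by (simp add: closed_arr_def arr_def sign_def parity_deg1 qp qps pst stq plus_commute)
  moreover have "cone_sigma c B = s" "cone_tau c B = t"
    unfolding cone_sigma_def cone_tau_def arrows by (simp_all add: qp qps)
  then have "natnat_obj A c B = P"
    using sigma_arr_proj(4) tau_arr_proj(4) natnat_obj_arrows[of c B]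
    by (metis prod_eqI cE W_def s_def t_def)
  ultimately show thesis by (rule that)
qed

lemma natnat_equivalence:
  assumes c: "\<And>X. X \<in> Obj A \<Longrightarrow> cone_data c X"
    and "idempotents_split (Z0 \<Gamma> A)" "has_twists \<Gamma> A"
  shows "dg_equivalence \<Gamma> A (nat_dg \<Gamma> (nat_dg \<Gamma> A)) (natnat_obj A c) (natnat_mor \<Gamma> A c)"
proof -
  have "\<exists>X\<in>Obj A. closed_isomorphic \<Gamma> (nat_dg \<Gamma> (nat_dg \<Gamma> A)) (natnat_obj A c X) P"
    if "P \<in> Obj (nat_dg \<Gamma> (nat_dg \<Gamma> A))" for P
  proof -
    obtain B c' where B: "cone_data c' B" "natnat_obj A c' B = P"
      using natnat_object_is_cone[OF assms(2,3) \<open>P \<in> _\<close>] .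
    have "B \<in> Obj A" by (rule cone_dataD(1)[OF B(1)])
    then show ?thesis
      using natnat_obj_isomorphic[OF c B(1)] B(2) by blast
  qed
  then show ?thesis
    unfolding dg_equivalence_def using natnat_functor[OF c] natnat_fully_faithful[OF c] by blast
qed

end

theorem proposition3p5:
  fixes \<Gamma> :: "('g::ab_group_add) grading"
    and A :: "('g, 'o, 'm) dgcat"
  assumes "dg_category \<Gamma> A"
    and "has_shifts \<Gamma> A"
    and "has_cones \<Gamma> A"
  shows "(\<exists>c. cone_choice_ok \<Gamma> A c) \<and>
    (\<forall>c. cone_choice_ok \<Gamma> A c \<longrightarrow>
       dg_functor \<Gamma> A (nat_dg \<Gamma> (nat_dg \<Gamma> A)) (natnat_obj A c) (natnat_mor \<Gamma> A c) \<and>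
       fully_faithful \<Gamma> A (nat_dg \<Gamma> (nat_dg \<Gamma> A)) (natnat_obj A c) (natnat_mor \<Gamma> A c) \<and>
       (idempotent_complete_additive_dg \<Gamma> A \<and> has_twists \<Gamma> A \<longrightarrow>
          dg_equivalence \<Gamma> A (nat_dg \<Gamma> (nat_dg \<Gamma> A)) (natnat_obj A c) (natnat_mor \<Gamma> A c)))"
proof -
  interpret dg_category \<Gamma> A by fact
  show ?thesis
  proof (intro conjI allI impI)
    show "\<exists>c. cone_choice_ok \<Gamma> A c"
      using assms(2,3) by (rule ex_cone_choice)
    fix c assume "cone_choice_ok \<Gamma> A c"
    then have c: "cone_data c X" if "X \<in> Obj A" for X
      using that by (simp add: cone_choice_ok_iff)
    show "dg_functor \<Gamma> A (nat_dg \<Gamma> (nat_dg \<Gamma> A)) (natnat_obj A c) (natnat_mor \<Gamma> A c)"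
      by (rule natnat_functor) (rule c)
    show "fully_faithful \<Gamma> A (nat_dg \<Gamma> (nat_dg \<Gamma> A)) (natnat_obj A c) (natnat_mor \<Gamma> A c)"
      by (rule natnat_fully_faithful) (rule c)
    assume "idempotent_complete_additive_dg \<Gamma> A \<and> has_twists \<Gamma> A"
    then show "dg_equivalence \<Gamma> A (nat_dg \<Gamma> (nat_dg \<Gamma> A)) (natnat_obj A c) (natnat_mor \<Gamma> A c)"
      by (intro natnat_equivalence c) (simp_all add: idempotent_complete_additive_dg_def)
  qed
qed

end
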